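(* Let $G$ be a finite connected graph with universal cover $T$, and let $\lambda_1(G)$ be the largest eigenvalue of its adjacency matrix. Then $\lambda_1(G) = \rho(T)$ if and only if $G$ has at most one cycle, and this holds if and only if the average degree of $G$ is at most $2$.
   Context: Graphs may have multiple edges and loops; a loop contributes $2$ to the degree of its vertex, and a loop or a pair of parallel edges counts as a cycle. The universal cover of a connected graph $G$ is the tree $T$ admitting a surjective graph homomorphism $\pi: T\to G$ that restricts to a bijection from the 1-neighbourhood (star) of each vertex $\hat v$ of $T$ onto that of $\pi(\hat v)$ in $G$. $\rho(T)$ is the operator norm of the adjacency operator of $T$ acting on $\ell^2(V(T))$. *)

theory Defs
  imports "HOL-Analysis.Analysis" "Graph_Theory.Graph_Theory"
begin

text \<open>
  A graph with loops and multiple edges is a bidirected digraph \<open>G\<close> with arc reversal \<open>r\<close>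
  (a graph in the sense of Serre): an undirected edge is a pair \<open>{a, r a}\<close> of mutually
  reverse arcs, and \<open>r\<close> has no fixed points on the arcs. In particular a loop consists of
  two arcs, both leaving its vertex, so that \<^const>\<open>out_degree\<close> is the degree in which a loop
  counts twice, and \<^const>\<open>out_arcs\<close> is the star of a vertex.
\<close>

definition average_degree :: "('v, 'e) pre_digraph \<Rightarrow> real" where
  "average_degree G = (\<Sum>v\<in>verts G. real (out_degree G v)) / real (card (verts G))"

text \<open>
  Cycles are subgraphs, represented by their sets of undirected edges. The library's
  \<^const>\<open>pre_digraph.cycle\<close> is a closed walk without repeated vertices; this also admits
  \<open>[a, r a]\<close>, going back and forth along one edge, which is excluded here (and which makes the
  library's \<^const>\<open>tree\<close> unsuitable for bidirected digraphs). Loops and pairs of parallel edges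
  are cycles.
\<close>

definition cycles :: "('v, 'e) pre_digraph \<Rightarrow> ('e \<Rightarrow> 'e) \<Rightarrow> 'e set set set" where
  "cycles G r = {(\<lambda>a. {a, r a}) ` set p | p.
     pre_digraph.cycle G p \<and> (\<forall>a\<in>set p. r a \<notin> set p)}"

definition at_most_one_cycle :: "('v, 'e) pre_digraph \<Rightarrow> ('e \<Rightarrow> 'e) \<Rightarrow> bool" where
  "at_most_one_cycle G r \<longleftrightarrow> (\<forall>C\<in>cycles G r. \<forall>D\<in>cycles G r. C = D)"

definition is_tree :: "('v, 'e) pre_digraph \<Rightarrow> ('e \<Rightarrow> 'e) \<Rightarrow> bool" where
  "is_tree G r \<longleftrightarrow> bidirected_digraph G r \<and> Digraph_Component.connected G \<and> cycles G r = {}"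

definition graph_hom ::
  "('w, 'f) pre_digraph \<Rightarrow> ('f \<Rightarrow> 'f) \<Rightarrow> ('v, 'e) pre_digraph \<Rightarrow> ('e \<Rightarrow> 'e) \<Rightarrow>
   ('w \<Rightarrow> 'v) \<Rightarrow> ('f \<Rightarrow> 'e) \<Rightarrow> bool" where
  "graph_hom H s G r \<pi>v \<pi>e \<longleftrightarrow>
     (\<forall>v\<in>verts H. \<pi>v v \<in> verts G) \<and>
     (\<forall>a\<in>arcs H. \<pi>e a \<in> arcs G \<and> tail G (\<pi>e a) = \<pi>v (tail H a) \<and>
        head G (\<pi>e a) = \<pi>v (head H a) \<and> \<pi>e (s a) = r (\<pi>e a))"

definition is_universal_cover ::
  "('w, 'f) pre_digraph \<Rightarrow> ('f \<Rightarrow> 'f) \<Rightarrow> ('v, 'e) pre_digraph \<Rightarrow> ('e \<Rightarrow> 'e) \<Rightarrow> bool" where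
  "is_universal_cover T s G r \<longleftrightarrow> is_tree T s \<and>
     (\<exists>\<pi>v \<pi>e. graph_hom T s G r \<pi>v \<pi>e \<and>
        \<pi>v ` verts T = verts G \<and> \<pi>e ` arcs T = arcs G \<and>
        (\<forall>v\<in>verts T. bij_betw \<pi>e (out_arcs T v) (out_arcs G (\<pi>v v))))"

text \<open>The diagonal entry at \<open>v\<close> is twice the number of loops at \<open>v\<close>.\<close>

definition adjacency_matrix :: "('v, 'e) pre_digraph \<Rightarrow> 'v \<Rightarrow> 'v \<Rightarrow> real" where
  "adjacency_matrix G u v = real (card {a \<in> arcs G. tail G a = u \<and> head G a = v})"

definition matrix_eigenvalues :: "'v set \<Rightarrow> ('v \<Rightarrow> 'v \<Rightarrow> real) \<Rightarrow> real set" where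
  "matrix_eigenvalues V A = {c. \<exists>x. (\<exists>v\<in>V. x v \<noteq> 0) \<and>
     (\<forall>u\<in>V. (\<Sum>v\<in>V. A u v * x v) = c * x u)}"

definition lambda1 :: "('v, 'e) pre_digraph \<Rightarrow> real" where
  "lambda1 G = Max (matrix_eigenvalues (verts G) (adjacency_matrix G))"

definition ell2 :: "'v set \<Rightarrow> ('v \<Rightarrow> complex) set" where
  "ell2 V = {f. (\<lambda>v. (cmod (f v))\<^sup>2) summable_on V}"

definition ell2_norm :: "'v set \<Rightarrow> ('v \<Rightarrow> complex) \<Rightarrow> real" where
  "ell2_norm V f = sqrt (\<Sum>\<^sub>\<infinity>v\<in>V. (cmod (f v))\<^sup>2)"

definition adjacency_op :: "('v, 'e) pre_digraph \<Rightarrow> ('v \<Rightarrow> complex) \<Rightarrow> 'v \<Rightarrow> complex" where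
  "adjacency_op G f v = (\<Sum>a\<in>out_arcs G v. f (head G a))"

text \<open>
  The operator norm on \<open>\<ell>\<^sup>2\<close> of the vertex set. It is used for graphs of bounded degree only,
  where \<^const>\<open>adjacency_op\<close> maps \<^const>\<open>ell2\<close> to itself and the supremum is finite.
\<close>

definition rho :: "('v, 'e) pre_digraph \<Rightarrow> real" where
  "rho G = (SUP f\<in>{f \<in> ell2 (verts G). ell2_norm (verts G) f \<le> 1}.
     ell2_norm (verts G) (adjacency_op G f))"

end

theory Submission
  imports Defs "Jordan_Normal_Form.Spectral_Radius"
begin

text \<open>
  Let \<open>x\<close> be the Perron eigenvector of \<open>G\<close>, \<open>y\<close> its lift to \<open>T\<close>, and \<open>\<theta>\<close> the eigenvalue. The Schur
  test bounds the norm of the adjacency operator by \<open>K\<close> as soon as there are arc weights \<open>c > 0\<close>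
  with \<open>c a * c (s a) = 1\<close> whose sum over every star is at most \<open>K\<close>; the weights
  \<open>y (head a) / y (tail a)\<close> give \<open>rho T \<le> \<theta>\<close>.

  If all cycles of \<open>G\<close> pass through one edge, count signed crossings of its lifts along paths from a
  root of \<open>T\<close>. A vertex of \<open>T\<close> is determined by its projection and this height, so the vertices of
  height in \<open>{-n..n}\<close> form a finite set left by at most two arcs. As \<open>T\<close> thus has finite sets with
  arbitrarily small relative boundary and \<open>y\<close> is bounded above and below, \<open>rho T = \<theta>\<close>.

  If \<open>G\<close> has more edges than vertices, there is a function \<open>\<sigma>\<close> on arcs for which
  \<open>\<sigma> a + \<sigma> (r a)\<close> and the star sums of \<open>\<sigma>\<close> are both constant, the former smaller than the latter:
  up to an additive constant this is a flow with prescribed divergence of total zero. Perturbing the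
  weights \<open>x (head a) / x (tail a)\<close> in the direction of \<open>\<sigma>\<close>, on the arcs of \<open>T\<close> that lead away from
  a root, decreases all star sums to first order, so \<open>rho T < \<theta>\<close>.

  Finally, if \<open>G\<close> has two cycles, deleting an edge of each leaves it connected, so it has more edges
  than vertices.
\<close>

section \<open>Reduced walks\<close>

lemma split_list_between:
  assumes "a \<in> set xs" "b \<in> set xs" "a \<noteq> b"
  obtains ys c zs d ws where "xs = ys @ c # zs @ d # ws" "{c, d} = {a, b}"
    "a \<notin> set zs" "b \<notin> set zs"
  using assms
proof (induction xs arbitrary: thesis)
  case (Cons x xs)
  show ?case
  proof (cases "a \<in> set xs \<and> b \<in> set xs")
    case True
    then obtain ys c zs d ws where "xs = ys @ c # zs @ d # ws" "{c, d} = {a, b}"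
      "a \<notin> set zs" "b \<notin> set zs"
      using Cons.IH Cons.prems(4) by blast
    then show ?thesis using Cons.prems(1)[of "x # ys" c zs d ws] by simp
  next
    case False
    then consider (a_first) "x = a" "a \<notin> set xs" "b \<in> set xs"
      | (b_first) "x = b" "b \<notin> set xs" "a \<in> set xs"
      using Cons.prems(2-4) by auto
    then show ?thesis
    proof cases
      case a_first
      then obtain zs ws where "xs = zs @ b # ws" "b \<notin> set zs" by (auto dest: split_list_first)
      then show ?thesis using a_first Cons.prems(1)[of "[]" a zs b ws] by auto
    next
      case b_first
      then obtain zs ws where "xs = zs @ a # ws" "a \<notin> set zs" by (auto dest: split_list_first)
      then show ?thesis using b_first Cons.prems(1)[of "[]" b zs a ws] by auto
    qed
  qed
qed simp

context bidirected_digraph begin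

definition edge :: "'b \<Rightarrow> 'b set" where
  "edge a = {a, arev a}"

lemma edge_eq_iff: "edge a = edge b \<longleftrightarrow> b \<in> edge a"
  by (auto simp: edge_def doubleton_eq_iff)

definition undirected_cycle :: "'b awalk \<Rightarrow> bool" where
  "undirected_cycle p \<longleftrightarrow> cycle p \<and> (\<forall>a\<in>set p. arev a \<notin> set p)"

lemma cycles_eq: "cycles G arev = {edge ` set p | p. undirected_cycle p}"
  unfolding cycles_def undirected_cycle_def edge_def[abs_def] ..

definition reduced :: "'b awalk \<Rightarrow> bool" where
  "reduced = successively (\<lambda>a b. b \<noteq> arev a)"

lemma reduced_Nil [simp]: "reduced []"
  by (simp add: reduced_def)

lemma reduced_append_iff:
  "reduced (p @ q) \<longleftrightarrow>
     reduced p \<and> reduced q \<and> (p = [] \<or> q = [] \<or> hd q \<noteq> arev (last p))"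
  by (auto simp: reduced_def successively_append_iff)

lemma reduced_Cons_iff: "reduced (a # p) \<longleftrightarrow> p = [] \<or> hd p \<noteq> arev a \<and> reduced p"
  by (auto simp: reduced_def successively_Cons)

lemma apath_imp_reduced: "apath u p v \<Longrightarrow> reduced p"
proof (induction p arbitrary: u)
  case (Cons a p)
  have "hd p \<noteq> arev a" if "p \<noteq> []"
    using Cons.prems that by (cases p; cases "tl p") (auto simp: apath_Cons_iff)
  then show ?case using Cons by (auto simp: apath_Cons_iff reduced_Cons_iff)
qed simp

lemma awalk_reverse: "awalk u p v \<Longrightarrow> awalk v (rev (map arev p)) u"
proof (induction p arbitrary: u)
  case (Cons a p)
  then have "a \<in> arcs G" "u = tail G a" "awalk v (rev (map arev p)) (head G a)"
    by (auto simp: awalk_Cons_iff)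
  then show ?case by (auto simp: awalk_simps)
qed (simp add: awalk_Nil_iff)

lemma reduced_reverse: "reduced p \<Longrightarrow> reduced (rev (map arev p))"
  by (auto simp: reduced_def successively_map elim: successively_mono)

lemma split_between_edge_reversal:
  assumes "a \<in> arcs G" "a \<in> set p" "arev a \<in> set p"
  obtains q e m q' where "p = q @ e # m @ arev e # q'" "edge e = edge a" "set m \<inter> edge a = {}"
proof -
  obtain q e m f q' where "p = q @ e # m @ f # q'" "{e, f} = {a, arev a}"
    "a \<notin> set m" "arev a \<notin> set m"
    using split_list_between[OF assms(2,3)] arev_neq[OF assms(1)] by metis
  moreover have "f = arev e" using \<open>{e, f} = _\<close> by (auto simp: doubleton_eq_iff)
  ultimately show thesis using that[of q e m q'] by (auto simp: edge_def)
qed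

lemma undirected_cycle_if_distinct_heads:
  assumes "awalk u p u" "reduced p" "p \<noteq> []" "distinct (map (head G) p)"
  shows "undirected_cycle p"
  unfolding undirected_cycle_def
proof (intro conjI ballI notI)
  have "cas u p u" using assms(1) by auto
  then show "cycle p"
    unfolding cycle_def using assms awalk_verts_conv' by auto
  fix a assume both_directions: "a \<in> set p" "arev a \<in> set p"
  moreover have "a \<in> arcs G" using both_directions(1) assms(1) by auto
  ultimately obtain q e m q' where p_split: "p = q @ e # m @ arev e # q'"
    using split_between_edge_reversal by blast
  show False
  proof (cases m rule: rev_cases)
    case Nil
    then show False using assms(2) by (simp add: p_split reduced_append_iff reduced_Cons_iff)
  next
    case (snoc m' d)
    then have "head G d = head G e" using assms(1) by (auto simp: p_split awalk_simps)
    then show False using assms(4) by (simp add: p_split snoc)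
  qed
qed

lemma reduced_closed_awalk_contains_cycle:
  assumes "awalk u p u" "reduced p" "p \<noteq> []"
  shows "\<exists>q. undirected_cycle q \<and> set q \<subseteq> set p"
  using assms
proof (induction "length p" arbitrary: p u rule: less_induct)
  case less
  show ?case
  proof (cases "distinct (map (head G) p)")
    case True
    then show ?thesis using undirected_cycle_if_distinct_heads less.prems by blast
  next
    case False
    then obtain xs ys zs y where "map (head G) p = xs @ [y] @ ys @ [y] @ zs"
      using not_distinct_decomp by blast
    then obtain p1 a p2 b p3 where p_split: "p = p1 @ a # p2 @ b # p3"
      and heads: "head G a = y" "head G b = y"
      by (auto simp: map_eq_append_conv map_eq_Cons_conv append_eq_map_conv Cons_eq_map_conv)
    have "awalk y (p2 @ [b]) y"
      using less.prems(1) p_split heads by (auto simp: awalk_simps intro: head_in_verts)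
    moreover have "reduced (p2 @ [b])"
      using less.prems(2) by (auto simp: p_split reduced_append_iff reduced_Cons_iff)
    moreover have "length (p2 @ [b]) < length p" by (simp add: p_split)
    ultimately obtain q where "undirected_cycle q" "set q \<subseteq> set (p2 @ [b])"
      using less.hyps[of "p2 @ [b]" y] by blast
    then show ?thesis using p_split by auto
  qed
qed

lemma reduced_awalk_unique:
  assumes acyclic: "cycles G arev = {}"
    and walk_p: "awalk u p v" "reduced p" and walk_q: "awalk u q v" "reduced q"
  shows "p = q"
proof -
  obtain ps p' q' where split: "p = ps @ p'" "q = ps @ q'"
    and diverge: "p' = [] \<or> q' = [] \<or> hd p' \<noteq> hd q'"
    using longest_common_prefix by blast
  obtain w where "awalk w p' v" "awalk w q' v"
    using walk_p(1) walk_q(1) unfolding split by auto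
  then have "awalk v (rev (map arev p') @ q') v"
    using awalk_reverse awalk_appendI by blast
  moreover have "reduced (rev (map arev p') @ q')"
    using walk_p(2) walk_q(2) diverge reduced_reverse[of p']
    by (auto simp: split reduced_append_iff last_rev hd_map)
  ultimately have "rev (map arev p') @ q' = []"
    using reduced_closed_awalk_contains_cycle acyclic unfolding cycles_eq by blast
  then show ?thesis by (simp add: split)
qed

end

section \<open>Counting edges\<close>

definition (in pre_digraph) arc_boundary :: "'a set \<Rightarrow> 'b set" where
  "arc_boundary U = {a \<in> arcs G. tail G a \<in> U \<and> head G a \<notin> U}"

lemma (in wf_digraph) awalk_meets_arc_boundary:
  "awalk u p v \<Longrightarrow> u \<in> U \<Longrightarrow> v \<notin> U \<Longrightarrow> set p \<inter> arc_boundary U \<noteq> {}"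
proof (induction p arbitrary: u)
  case (Cons a p)
  then show ?case
    by (cases "head G a \<in> U") (auto simp: awalk_Cons_iff arc_boundary_def)
qed (simp add: awalk_Nil_iff)

context bidirected_digraph begin

lemma arc_boundary_Compl: "a \<in> arcs G \<Longrightarrow> a \<in> arc_boundary (- U) \<longleftrightarrow> arev a \<in> arc_boundary U"
  by (auto simp: arc_boundary_def)

definition connecting :: "'b set \<Rightarrow> bool" where
  "connecting A \<longleftrightarrow> A \<subseteq> arcs G \<and> arev ` A \<subseteq> A \<and>
     (\<forall>U \<subseteq> verts G. U \<noteq> {} \<longrightarrow> U \<noteq> verts G \<longrightarrow> A \<inter> arc_boundary U \<noteq> {})"

lemma connectingD:
  assumes "connecting A" "U \<subseteq> verts G" "U \<noteq> {}" "U \<noteq> verts G"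
  obtains a where "a \<in> A" "a \<in> arcs G" "tail G a \<in> U" "head G a \<notin> U"
proof -
  have "A \<inter> arc_boundary U \<noteq> {}" using assms unfolding connecting_def by blast
  then show thesis using that by (auto simp: arc_boundary_def)
qed

lemma connected_imp_apath:
  assumes "Digraph_Component.connected G" "u \<in> verts G" "v \<in> verts G"
  shows "\<exists>p. apath u p v"
  using symmetric_connected_imp_strongly_connected[OF sym_arcs assms(1)] assms(2,3)
  by (auto simp: strongly_connected_def reachable_apath)

lemma connected_imp_connecting_arcs:
  assumes "Digraph_Component.connected G"
  shows "connecting (arcs G)"
  unfolding connecting_def
proof (intro conjI allI impI)
  fix U assume "U \<subseteq> verts G" "U \<noteq> {}" "U \<noteq> verts G"
  then obtain u v where "u \<in> U" "v \<in> verts G" "v \<notin> U" "u \<in> verts G" by blast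
  then obtain p where "awalk u p v"
    using connected_imp_apath[OF assms] by (blast dest: awalkI_apath)
  then have "set p \<inter> arc_boundary U \<noteq> {}"
    using \<open>u \<in> U\<close> \<open>v \<notin> U\<close> by (rule awalk_meets_arc_boundary)
  then show "arcs G \<inter> arc_boundary U \<noteq> {}" by (auto simp: arc_boundary_def)
qed auto

lemma connecting_imp_many_arcs_inside:
  assumes connecting_A: "connecting A" "finite A" and finite_verts: "finite (verts G)"
    and size_bound: "Suc k \<le> card (verts G)"
  shows "\<exists>U\<subseteq>verts G. card U = Suc k \<and> 2 * k \<le> card {a \<in> A. tail G a \<in> U \<and> head G a \<in> U}"
  using size_bound
proof (induction k)
  case 0
  then obtain v where "v \<in> verts G" by fastforce
  then show ?case by (intro exI[of _ "{v}"]) auto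
next
  case (Suc k)
  let ?inside = "\<lambda>U. {a \<in> A. tail G a \<in> U \<and> head G a \<in> U}"
  from Suc obtain U where U_props: "U \<subseteq> verts G" "card U = Suc k" "2 * k \<le> card (?inside U)"
    by auto
  have "U \<noteq> {}" "U \<noteq> verts G" using U_props(2) Suc.prems by auto
  then obtain a where leaving: "a \<in> A" "a \<in> arcs G" "tail G a \<in> U" "head G a \<notin> U"
    using connectingD[OF connecting_A(1) U_props(1)] by blast
  let ?U = "insert (head G a) U"
  have "arev a \<in> A" using connecting_A(1) leaving(1) by (auto simp: connecting_def)
  have "2 + card (?inside U) = card (edge a \<union> ?inside U)"
    using leaving connecting_A(2) arev_neq[OF leaving(2)]
    by (subst card_Un_disjoint) (auto simp: edge_def)
  also have "\<dots> \<le> card (?inside ?U)"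
    using leaving connecting_A(2) \<open>arev a \<in> A\<close> by (intro card_mono) (auto simp: edge_def)
  finally have "2 * Suc k \<le> card (?inside ?U)" using U_props(3) by simp
  moreover have "card ?U = Suc (Suc k)"
    using U_props(2) leaving(4) finite_subset[OF U_props(1) finite_verts] by simp
  ultimately show ?case
    using U_props(1) leaving(2) by (intro exI[of _ ?U]) auto
qed

lemma card_verts_le_card_connecting:
  assumes "connecting A" "finite A" "finite (verts G)"
  shows "2 * card (verts G) \<le> card A + 2"
proof (cases "card (verts G)")
  case (Suc k)
  then obtain U where "2 * k \<le> card {a \<in> A. tail G a \<in> U \<and> head G a \<in> U}"
    using connecting_imp_many_arcs_inside[OF assms, of k] by auto
  also have "\<dots> \<le> card A" using assms(2) by (intro card_mono) auto
  finally show ?thesis using Suc by simp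
qed simp

lemma card_Diff_edge:
  assumes "finite A" "A \<subseteq> arcs G" "arev ` A \<subseteq> A" "a \<in> A"
  shows "card (A - edge a) + 2 = card A"
proof -
  have "edge a \<subseteq> A" "card (edge a) = 2"
    using assms arev_neq[of a] by (auto simp: edge_def card_insert_if)
  then show ?thesis
    using card_Diff_subset[of "edge a" A] card_mono[OF assms(1), of "edge a"]
    by (simp add: edge_def)
qed

lemma connecting_Diff_edge_of_cycle:
  assumes connecting_A: "connecting A" and cycle_q: "undirected_cycle q" "set q \<subseteq> A"
    and a_in_q: "a \<in> set q"
  shows "connecting (A - edge a)"
  unfolding connecting_def
proof (intro conjI allI impI)
  show "A - edge a \<subseteq> arcs G" "arev ` (A - edge a) \<subseteq> A - edge a"
    using connecting_A by (auto simp: connecting_def edge_def arev_eq_iff)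
  have reversal: "arev b \<in> A" "b \<in> arcs G" if "b \<in> A" for b
    using connecting_A that by (auto simp: connecting_def)
  obtain u where closed_q: "awalk u q u" and distinct_q: "distinct q"
    using cycle_q(1) unfolding undirected_cycle_def cycle_conv by blast
  obtain q1 q2 where split: "q = q1 @ a # q2" using a_in_q by (auto dest: split_list)
  have detour: "awalk (head G a) (q2 @ q1) (tail G a)"
    using closed_q unfolding split by (auto simp: awalk_Cons_iff)
  have in_Diff: "b \<in> A - edge a" "arev b \<in> A - edge a" if "b \<in> set (q2 @ q1)" for b
    using distinct_q cycle_q a_in_q that reversal[of b] unfolding split
    by (auto simp: undirected_cycle_def edge_def arev_eq_iff)
  fix U assume "U \<subseteq> verts G" "U \<noteq> {}" "U \<noteq> verts G"
  then obtain b where leaving: "b \<in> A" "tail G b \<in> U" "head G b \<notin> U"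
    using connectingD[OF connecting_A] by blast
  consider (other) "b \<notin> edge a" | (forward) "b = a" | (backward) "b = arev a"
    by (auto simp: edge_def)
  then show "(A - edge a) \<inter> arc_boundary U \<noteq> {}"
  proof cases
    case other
    then show ?thesis using leaving reversal(2) by (auto simp: arc_boundary_def)
  next
    case forward
    then obtain c where crossing: "c \<in> set (q2 @ q1)" "c \<in> arc_boundary (- U)"
      using awalk_meets_arc_boundary[OF detour, of "- U"] leaving by auto
    then have "arev c \<in> arc_boundary U"
      using arc_boundary_Compl by (simp add: arc_boundary_def)
    then show ?thesis using in_Diff[OF crossing(1)] by blast
  next
    case backward
    then have "head G a \<in> U" "tail G a \<notin> U"
      using leaving reversal(2)[of a] a_in_q cycle_q(2) by auto
    then show ?thesis using awalk_meets_arc_boundary[OF detour] in_Diff by blast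
  qed
qed

lemma card_arcs_ge_if_two_cycles:
  assumes "fin_digraph G" "Digraph_Component.connected G" "\<not> at_most_one_cycle G arev"
  shows "2 * card (verts G) + 2 \<le> card (arcs G)"
proof -
  interpret fin_digraph G by fact
  obtain p q where cycle_p: "undirected_cycle p" and cycle_q: "undirected_cycle q"
    and "\<not> edge ` set p \<subseteq> edge ` set q"
    using assms(3) unfolding at_most_one_cycle_def cycles_eq by blast
  then obtain a where a_in_p: "a \<in> set p" "edge a \<notin> edge ` set q" by blast
  have "q \<noteq> []" using cycle_q by (auto simp: undirected_cycle_def cycle_def)
  then obtain b where b_in_q: "b \<in> set q" using hd_in_set by blast
  have arcs: "set p \<subseteq> arcs G" "set q \<subseteq> arcs G"
    using cycle_p cycle_q by (auto simp: undirected_cycle_def cycle_def)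
  let ?A = "arcs G - edge a"
  let ?B = "?A - edge b"
  have "set q \<subseteq> ?A" using a_in_p(2) arcs(2) by (auto simp: edge_eq_iff)
  have connecting_A: "connecting ?A"
    using connecting_Diff_edge_of_cycle[OF connected_imp_connecting_arcs cycle_p] assms(2)
      arcs(1) a_in_p(1)
    by blast
  then have "connecting ?B"
    using connecting_Diff_edge_of_cycle cycle_q \<open>set q \<subseteq> ?A\<close> b_in_q by blast
  then have "2 * card (verts G) \<le> card ?B + 2"
    by (rule card_verts_le_card_connecting) auto
  moreover have "card ?B + 2 = card ?A"
    using connecting_A b_in_q \<open>set q \<subseteq> ?A\<close> by (intro card_Diff_edge) (auto simp: connecting_def)
  moreover have "card ?A + 2 = card (arcs G)"
    using a_in_p(1) arcs(1) by (intro card_Diff_edge) auto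
  ultimately show ?thesis by linarith
qed

end

section \<open>Flows\<close>

lemma (in fin_digraph) sum_out_arcs:
  "(\<Sum>v\<in>verts G. \<Sum>a\<in>out_arcs G v. f a) = (\<Sum>a\<in>arcs G. f a)"
  unfolding out_arcs_def by (rule sum.group) auto

lemma (in fin_digraph) average_degree_eq: "average_degree G = card (arcs G) / card (verts G)"
proof -
  have "(\<Sum>v\<in>verts G. real (out_degree G v)) = (\<Sum>v\<in>verts G. \<Sum>a\<in>out_arcs G v. 1)"
    by (simp add: out_degree_def)
  also have "\<dots> = card (arcs G)"
    by (subst sum_out_arcs) simp
  finally show ?thesis by (simp add: average_degree_def)
qed

context bidirected_digraph begin

definition flow_with_divergence :: "('b \<Rightarrow> 'k::comm_ring_1) \<Rightarrow> ('a \<Rightarrow> 'k) \<Rightarrow> bool" where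
  "flow_with_divergence \<eta> d \<longleftrightarrow> (\<forall>a\<in>arcs G. \<eta> (arev a) = - \<eta> a) \<and>
     (\<forall>v\<in>verts G. (\<Sum>a\<in>out_arcs G v. \<eta> a) = d v)"

lemma flow_with_divergence_add:
  assumes "flow_with_divergence \<eta> d" "flow_with_divergence \<eta>' d'"
  shows "flow_with_divergence (\<lambda>a. \<eta> a + \<eta>' a) (\<lambda>v. d v + d' v)"
  using assms by (simp add: flow_with_divergence_def sum.distrib)

lemma flow_with_divergence_linear_combination:
  assumes "\<And>i. i \<in> I \<Longrightarrow> flow_with_divergence (\<eta> i) (d i)"
  shows "flow_with_divergence (\<lambda>a. \<Sum>i\<in>I. c i * \<eta> i a) (\<lambda>v. \<Sum>i\<in>I. c i * d i v)"
  unfolding flow_with_divergence_def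
proof (intro conjI ballI)
  fix a assume "a \<in> arcs G"
  then show "(\<Sum>i\<in>I. c i * \<eta> i (arev a)) = - (\<Sum>i\<in>I. c i * \<eta> i a)"
    using assms by (simp add: flow_with_divergence_def sum_negf)
next
  fix v assume "v \<in> verts G"
  have "(\<Sum>a\<in>out_arcs G v. \<Sum>i\<in>I. c i * \<eta> i a) = (\<Sum>i\<in>I. c i * (\<Sum>a\<in>out_arcs G v. \<eta> i a))"
    by (subst sum.swap) (simp add: sum_distrib_left)
  then show "(\<Sum>a\<in>out_arcs G v. \<Sum>i\<in>I. c i * \<eta> i a) = (\<Sum>i\<in>I. c i * d i v)"
    using assms \<open>v \<in> verts G\<close> by (simp add: flow_with_divergence_def)
qed

lemma flow_with_divergence_of_arc:
  assumes "b \<in> arcs G" and locally_finite: "\<And>v. v \<in> verts G \<Longrightarrow> finite (out_arcs G v)"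
  shows "flow_with_divergence (\<lambda>a. of_bool (a = b) - of_bool (a = arev b) :: 'k::comm_ring_1)
    (\<lambda>v. of_bool (v = tail G b) - of_bool (v = head G b))"
  unfolding flow_with_divergence_def
proof (intro conjI ballI)
  fix a assume "a \<in> arcs G"
  have "arev a = b \<longleftrightarrow> a = arev b" by auto
  then show "of_bool (arev a = b) - of_bool (arev a = arev b) =
      - (of_bool (a = b) - of_bool (a = arev b) :: 'k)"
    by (simp add: arev_eq_iff)
next
  fix v assume "v \<in> verts G"
  moreover have "b \<in> out_arcs G v \<longleftrightarrow> v = tail G b" "arev b \<in> out_arcs G v \<longleftrightarrow> v = head G b"
    using assms(1) by auto
  ultimately show "(\<Sum>a\<in>out_arcs G v. of_bool (a = b) - of_bool (a = arev b)) =
      (of_bool (v = tail G b) - of_bool (v = head G b) :: 'k)"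
    using locally_finite by (simp add: sum_subtractf of_bool_def)
qed

lemma exists_dipole_flow:
  assumes "awalk u p v" and locally_finite: "\<And>v. v \<in> verts G \<Longrightarrow> finite (out_arcs G v)"
  shows "\<exists>\<eta> :: 'b \<Rightarrow> 'k::comm_ring_1.
    flow_with_divergence \<eta> (\<lambda>w. of_bool (w = u) - of_bool (w = v))"
  using assms(1)
proof (induction p arbitrary: u)
  case Nil
  then have "flow_with_divergence (\<lambda>_. 0 :: 'k) (\<lambda>w. of_bool (w = u) - of_bool (w = v))"
    by (simp add: flow_with_divergence_def awalk_Nil_iff)
  then show ?case by blast
next
  case (Cons b p)
  then have first_arc: "b \<in> arcs G" "u = tail G b" and "awalk (head G b) p v"
    by (auto simp: awalk_Cons_iff)
  then obtain \<eta> :: "'b \<Rightarrow> 'k" where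
    "flow_with_divergence \<eta> (\<lambda>w. of_bool (w = head G b) - of_bool (w = v))"
    using Cons.IH by blast
  from flow_with_divergence_add[OF flow_with_divergence_of_arc[OF first_arc(1) locally_finite] this]
  show ?case using first_arc(2) by auto
qed

lemma exists_flow_with_divergence:
  fixes d :: "'a \<Rightarrow> 'k::comm_ring_1"
  assumes "fin_digraph G" "Digraph_Component.connected G" "(\<Sum>v\<in>verts G. d v) = 0"
  shows "\<exists>\<eta>. flow_with_divergence \<eta> d"
proof -
  interpret fin_digraph G by fact
  obtain v0 where v0_in_verts: "v0 \<in> verts G" using assms(2) by (auto simp: connected_conv)
  have "\<exists>\<eta> :: 'b \<Rightarrow> 'k. flow_with_divergence \<eta> (\<lambda>w. of_bool (w = v) - of_bool (w = v0))"
    if v_in_verts: "v \<in> verts G" for v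
  proof -
    obtain p where "awalk v p v0"
      using connected_imp_apath[OF assms(2) v_in_verts v0_in_verts] by (blast dest: awalkI_apath)
    then show ?thesis by (rule exists_dipole_flow) auto
  qed
  then obtain \<eta> :: "'a \<Rightarrow> 'b \<Rightarrow> 'k" where
    dipole: "\<And>v. v \<in> verts G \<Longrightarrow> flow_with_divergence (\<eta> v) (\<lambda>w. of_bool (w = v) - of_bool (w = v0))"
    by metis
  let ?\<eta> = "\<lambda>a. \<Sum>v\<in>verts G. d v * \<eta> v a"
  from dipole have "flow_with_divergence ?\<eta>
      (\<lambda>w. \<Sum>v\<in>verts G. d v * (of_bool (w = v) - of_bool (w = v0)))"
    by (rule flow_with_divergence_linear_combination)
  moreover have "(\<Sum>v\<in>verts G. d v * (of_bool (w = v) - of_bool (w = v0))) = d w"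
    if "w \<in> verts G" for w
  proof -
    have "(\<Sum>v\<in>verts G. d v * (of_bool (w = v) - of_bool (w = v0))) =
        (\<Sum>v\<in>verts G. (if w = v then d v else 0) - d v * of_bool (w = v0))"
      by (intro sum.cong) (auto simp: right_diff_distrib)
    also have "\<dots> = (\<Sum>v\<in>verts G. if w = v then d v else 0) -
        (\<Sum>v\<in>verts G. d v) * of_bool (w = v0)"
      by (simp only: sum_subtractf sum_distrib_right)
    finally show ?thesis using that assms(3) by simp
  qed
  ultimately have "flow_with_divergence ?\<eta> d" by (simp add: flow_with_divergence_def)
  then show ?thesis by (intro exI[of _ ?\<eta>])
qed

end

section \<open>Eigenvalues of finite matrices\<close>

lemma matrix_eigenvalues_subset_spectrum:
  fixes A :: "'v \<Rightarrow> 'v \<Rightarrow> real"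
  assumes enum: "bij_betw e {0..<n} V"
  shows "matrix_eigenvalues V A \<subseteq> spectrum (Matrix.mat n n (\<lambda>(i, j). A (e i) (e j)))"
    (is "_ \<subseteq> spectrum ?M")
proof
  fix c assume "c \<in> matrix_eigenvalues V A"
  then obtain x where nonzero: "\<exists>v\<in>V. x v \<noteq> 0"
    and eigen: "\<And>u. u \<in> V \<Longrightarrow> (\<Sum>v\<in>V. A u v * x v) = c * x u"
    by (auto simp: matrix_eigenvalues_def)
  define y where "y = Matrix.vec n (\<lambda>i. x (e i))"
  obtain v where "v \<in> e ` {0..<n}" "x v \<noteq> 0"
    using nonzero bij_betw_imp_surj_on[OF enum] by blast
  then obtain i where "i < n" "x (e i) \<noteq> 0" by auto
  then have "y \<noteq> 0\<^sub>v n" by (metis index_vec index_zero_vec(1) y_def)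
  moreover have "?M *\<^sub>v y = c \<cdot>\<^sub>v y"
  proof (rule eq_vecI)
    fix i assume "i < dim_vec (c \<cdot>\<^sub>v y)"
    then have "i < n" by (simp add: y_def)
    then have "e i \<in> V" using enum by (auto simp: bij_betw_def)
    have "vec_index (?M *\<^sub>v y) i = (\<Sum>j = 0..<n. A (e i) (e j) * x (e j))"
      using \<open>i < n\<close> by (simp add: y_def scalar_prod_def)
    also have "\<dots> = (\<Sum>v\<in>V. A (e i) v * x v)" by (rule sum.reindex_bij_betw[OF enum])
    finally show "vec_index (?M *\<^sub>v y) i = vec_index (c \<cdot>\<^sub>v y) i"
      using eigen[OF \<open>e i \<in> V\<close>] \<open>i < n\<close> by (simp add: y_def)
  qed (simp add: y_def)
  ultimately have "eigenvector ?M y c" by (simp add: eigenvector_def y_def)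
  then show "c \<in> spectrum ?M" by (auto simp: spectrum_def eigenvalue_def)
qed

lemma finite_matrix_eigenvalues:
  fixes A :: "'v \<Rightarrow> 'v \<Rightarrow> real"
  assumes "finite V"
  shows "finite (matrix_eigenvalues V A)"
proof -
  obtain e where "bij_betw e {0..<card V} V"
    using ex_bij_betw_nat_finite[OF assms] by blast
  then show ?thesis
    by (rule finite_subset[OF matrix_eigenvalues_subset_spectrum])
      (rule card_finite_spectrum(1)[OF mat_carrier])
qed

definition bilinear_form ::
    "'v set \<Rightarrow> ('v \<Rightarrow> 'v \<Rightarrow> real) \<Rightarrow> ('v \<Rightarrow> real) \<Rightarrow> ('v \<Rightarrow> real) \<Rightarrow> real" where
  "bilinear_form V A x y = (\<Sum>u\<in>V. x u * (\<Sum>v\<in>V. A u v * y v))"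

lemma bilinear_form_cong:
  assumes "\<And>v. v \<in> V \<Longrightarrow> x v = x' v" "\<And>v. v \<in> V \<Longrightarrow> y v = y' v"
  shows "bilinear_form V A x y = bilinear_form V A x' y'"
  using assms by (simp add: bilinear_form_def)

lemma bilinear_form_scale:
  "bilinear_form V A (\<lambda>v. c * x v) (\<lambda>v. c * x v) = c\<^sup>2 * bilinear_form V A x x"
  by (simp add: bilinear_form_def sum_distrib_left power2_eq_square mult_ac)

lemma bilinear_form_commute:
  assumes "\<And>u v. u \<in> V \<Longrightarrow> v \<in> V \<Longrightarrow> A u v = A v u"
  shows "bilinear_form V A x y = bilinear_form V A y x"
proof -
  have "bilinear_form V A x y = (\<Sum>u\<in>V. \<Sum>v\<in>V. x u * (A u v * y v))"
    by (simp add: bilinear_form_def sum_distrib_left)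
  also have "\<dots> = (\<Sum>v\<in>V. \<Sum>u\<in>V. x u * (A u v * y v))" by (rule sum.swap)
  also have "\<dots> = bilinear_form V A y x"
    unfolding bilinear_form_def sum_distrib_left
    using assms by (intro sum.cong) (auto simp: mult_ac)
  finally show ?thesis .
qed

lemma bilinear_form_add_scale:
  assumes "\<And>u v. u \<in> V \<Longrightarrow> v \<in> V \<Longrightarrow> A u v = A v u"
  shows "bilinear_form V A (\<lambda>v. x v + t * y v) (\<lambda>v. x v + t * y v) =
    bilinear_form V A x x + 2 * t * bilinear_form V A y x + t\<^sup>2 * bilinear_form V A y y"
proof -
  have "bilinear_form V A (\<lambda>v. x v + t * y v) (\<lambda>v. x v + t * y v) =
      bilinear_form V A x x + t * bilinear_form V A x y + t * bilinear_form V A y x +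
      t\<^sup>2 * bilinear_form V A y y"
    by (simp add: bilinear_form_def algebra_simps sum.distrib sum_distrib_left power2_eq_square)
  moreover have "bilinear_form V A x y = bilinear_form V A y x"
    using assms by (rule bilinear_form_commute)
  ultimately show ?thesis by simp
qed

lemma bilinear_form_le_abs:
  assumes "\<And>u v. u \<in> V \<Longrightarrow> v \<in> V \<Longrightarrow> 0 \<le> A u v"
  shows "bilinear_form V A z z \<le> bilinear_form V A (\<lambda>v. \<bar>z v\<bar>) (\<lambda>v. \<bar>z v\<bar>)"
  unfolding bilinear_form_def sum_distrib_left
proof (intro sum_mono)
  fix u v assume "u \<in> V" "v \<in> V"
  then have "A u v * (z u * z v) \<le> A u v * (\<bar>z u\<bar> * \<bar>z v\<bar>)"
    using assms by (intro mult_left_mono) (auto simp: abs_mult[symmetric])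
  then show "z u * (A u v * z v) \<le> \<bar>z u\<bar> * (A u v * \<bar>z v\<bar>)" by (simp add: mult_ac)
qed

lemma positive_semidefinite_isotropic_imp_kernel:
  assumes "finite V" and sym: "\<And>u v. u \<in> V \<Longrightarrow> v \<in> V \<Longrightarrow> A u v = A v u"
    and psd: "\<And>z. 0 \<le> bilinear_form V A z z" and isotropic: "bilinear_form V A x x = 0"
    and "u \<in> V"
  shows "(\<Sum>v\<in>V. A u v * x v) = 0"
proof -
  define y where "y u = (\<Sum>v\<in>V. A u v * x v)" for u
  define f where "f t = bilinear_form V A (\<lambda>v. x v + t * y v) (\<lambda>v. x v + t * y v)" for t
  have f_quadratic: "f t = 2 * t * bilinear_form V A y x + t\<^sup>2 * bilinear_form V A y y" for t
    unfolding f_def by (subst bilinear_form_add_scale) (use sym isotropic in auto)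
  have "(f has_real_derivative 2 * bilinear_form V A y x) (at 0)"
    unfolding f_quadratic by (auto intro!: derivative_eq_intros)
  moreover have "f 0 \<le> f t" for t using psd f_quadratic[of 0] by (simp add: f_def)
  ultimately have "2 * bilinear_form V A y x = 0"
    by (intro DERIV_local_min[of f _ 0 1]) auto
  then have "(\<Sum>u\<in>V. (y u)\<^sup>2) = 0"
    by (simp add: bilinear_form_def y_def power2_eq_square)
  then show ?thesis
    using assms(1) \<open>u \<in> V\<close> by (simp add: sum_nonneg_eq_0_iff y_def)
qed

definition nonneg_unit_sphere :: "'v set \<Rightarrow> ('v \<Rightarrow> real) set" where
  "nonneg_unit_sphere V =
     {x. (\<forall>v\<in>V. 0 \<le> x v) \<and> (\<forall>v. v \<notin> V \<longrightarrow> x v = 0) \<and> (\<Sum>v\<in>V. (x v)\<^sup>2) = 1}"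

lemma nonneg_unit_sphere_nonempty:
  assumes "finite V" "V \<noteq> {}"
  shows "nonneg_unit_sphere V \<noteq> {}"
proof -
  obtain v where "v \<in> V" using assms(2) by blast
  then have "(\<lambda>u. of_bool (u = v)) \<in> nonneg_unit_sphere V"
    using assms(1)
    by (auto simp: nonneg_unit_sphere_def of_bool_def if_distrib[of "\<lambda>c. c ^ _"] cong: if_cong)
  then show ?thesis by blast
qed

lemma compact_nonneg_unit_sphere:
  fixes V :: "'v set"
  assumes "finite V"
  shows "compact (nonneg_unit_sphere V)"
proof -
  let ?S = "\<lambda>v. if v \<in> V then {0..1} else {0::real}"
  have "compactin (product_topology (\<lambda>_::'v. euclidean) UNIV) (PiE UNIV ?S)"
    by (subst compactin_PiE) auto
  then have "compact (PiE UNIV ?S)" by (simp add: euclidean_product_topology)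
  moreover have "closed {x :: 'v \<Rightarrow> real. (\<Sum>v\<in>V. (x v)\<^sup>2) = 1}"
    by (intro closed_Collect_eq continuous_intros continuous_on_product_coordinates)
  moreover have "x v \<le> 1" if "(\<Sum>v\<in>V. (x v)\<^sup>2) = 1" "v \<in> V" for x :: "'v \<Rightarrow> real" and v
    using member_le_sum[of v V "\<lambda>v. (x v)\<^sup>2"] that assms by (auto simp: abs_square_le_1)
  then have "nonneg_unit_sphere V = PiE UNIV ?S \<inter> {x. (\<Sum>v\<in>V. (x v)\<^sup>2) = 1}"
    by (auto simp: nonneg_unit_sphere_def PiE_UNIV_domain Pi_def split: if_splits)
  ultimately show ?thesis by (simp only: compact_Int_closed)
qed

lemma exists_nonneg_unit_vector_dominating:
  assumes "finite V" and nonneg: "\<And>u v. u \<in> V \<Longrightarrow> v \<in> V \<Longrightarrow> 0 \<le> A u v"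
    and norm_pos: "0 < (\<Sum>v\<in>V. (z v)\<^sup>2)"
  shows "\<exists>w\<in>nonneg_unit_sphere V.
    bilinear_form V A z z \<le> bilinear_form V A w w * (\<Sum>v\<in>V. (z v)\<^sup>2)"
proof
  let ?N = "\<Sum>v\<in>V. (z v)\<^sup>2"
  define c where "c = 1 / sqrt ?N"
  let ?w = "\<lambda>v. if v \<in> V then c * \<bar>z v\<bar> else 0"
  have scaling: "0 \<le> c" "c\<^sup>2 * ?N = 1" using norm_pos by (simp_all add: c_def power_divide)
  have "(\<Sum>v\<in>V. (?w v)\<^sup>2) = c\<^sup>2 * ?N"
    by (simp add: power_mult_distrib sum_distrib_left)
  then show "?w \<in> nonneg_unit_sphere V"
    using scaling by (simp add: nonneg_unit_sphere_def)
  have "bilinear_form V A z z \<le> bilinear_form V A (\<lambda>v. \<bar>z v\<bar>) (\<lambda>v. \<bar>z v\<bar>)"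
    by (intro bilinear_form_le_abs nonneg)
  also have "\<dots> = c\<^sup>2 * ?N * bilinear_form V A (\<lambda>v. \<bar>z v\<bar>) (\<lambda>v. \<bar>z v\<bar>)"
    unfolding scaling(2) by simp
  also have "\<dots> = bilinear_form V A (\<lambda>v. c * \<bar>z v\<bar>) (\<lambda>v. c * \<bar>z v\<bar>) * ?N"
    unfolding bilinear_form_scale by (simp only: mult_ac)
  also have "bilinear_form V A (\<lambda>v. c * \<bar>z v\<bar>) (\<lambda>v. c * \<bar>z v\<bar>) = bilinear_form V A ?w ?w"
    by (rule bilinear_form_cong) auto
  finally show "bilinear_form V A z z \<le> bilinear_form V A ?w ?w * ?N" .
qed

lemma exists_nonneg_Rayleigh_maximizer:
  fixes A :: "'v \<Rightarrow> 'v \<Rightarrow> real"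
  assumes finite_nonempty: "finite V" "V \<noteq> {}"
    and nonneg: "\<And>u v. u \<in> V \<Longrightarrow> v \<in> V \<Longrightarrow> 0 \<le> A u v"
  shows "\<exists>x\<in>nonneg_unit_sphere V.
    \<forall>z. bilinear_form V A z z \<le> bilinear_form V A x x * (\<Sum>v\<in>V. (z v)\<^sup>2)"
proof -
  let ?Q = "\<lambda>z. bilinear_form V A z z" and ?N = "\<lambda>z :: 'v \<Rightarrow> real. \<Sum>v\<in>V. (z v)\<^sup>2"
  have "continuous_on UNIV ?Q"
    unfolding bilinear_form_def by (intro continuous_intros continuous_on_product_coordinates)
  then have "continuous_on (nonneg_unit_sphere V) ?Q" by (rule continuous_on_subset) simp
  with compact_nonneg_unit_sphere[OF finite_nonempty(1)]
    nonneg_unit_sphere_nonempty[OF finite_nonempty]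
  have "\<exists>x\<in>nonneg_unit_sphere V. \<forall>w\<in>nonneg_unit_sphere V. ?Q w \<le> ?Q x"
    by (rule continuous_attains_sup)
  then obtain x where maximizer: "x \<in> nonneg_unit_sphere V"
    "\<And>w. w \<in> nonneg_unit_sphere V \<Longrightarrow> ?Q w \<le> ?Q x"
    by blast
  have "?Q z \<le> ?Q x * ?N z" for z
  proof (cases "?N z = 0")
    case True
    then have "\<And>v. v \<in> V \<Longrightarrow> z v = 0"
      using finite_nonempty(1) by (simp add: sum_nonneg_eq_0_iff)
    then show ?thesis by (simp add: bilinear_form_def)
  next
    case False
    then have norm_pos: "0 < ?N z" using sum_nonneg[of V "\<lambda>v. (z v)\<^sup>2"] by simp
    then obtain w where w_in_sphere: "w \<in> nonneg_unit_sphere V"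
      and dominating: "?Q z \<le> ?Q w * ?N z"
      using exists_nonneg_unit_vector_dominating[of V A z] finite_nonempty(1) nonneg by blast
    note dominating
    also have "?Q w * ?N z \<le> ?Q x * ?N z"
      using maximizer(2)[OF w_in_sphere] norm_pos by (intro mult_right_mono) auto
    finally show ?thesis .
  qed
  then show ?thesis using maximizer(1) by blast
qed

lemma Rayleigh_maximizer_imp_eigenvector:
  assumes "finite V" and sym: "\<And>u v. u \<in> V \<Longrightarrow> v \<in> V \<Longrightarrow> A u v = A v u"
    and Rayleigh_le: "\<And>z. bilinear_form V A z z \<le> \<mu> * (\<Sum>v\<in>V. (z v)\<^sup>2)"
    and Rayleigh_eq: "bilinear_form V A x x = \<mu> * (\<Sum>v\<in>V. (x v)\<^sup>2)"
    and "u \<in> V"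
  shows "(\<Sum>v\<in>V. A u v * x v) = \<mu> * x u"
proof -
  define M where "M u v = (if u = v then \<mu> else 0) - A u v" for u v
  have M_apply: "(\<Sum>v\<in>V. M u v * z v) = \<mu> * z u - (\<Sum>v\<in>V. A u v * z v)" if "u \<in> V" for u z
    using that assms(1)
    by (simp add: M_def left_diff_distrib sum_subtractf if_distrib[of "\<lambda>c. c * _"] cong: if_cong)
  have form_M: "bilinear_form V M z z = \<mu> * (\<Sum>v\<in>V. (z v)\<^sup>2) - bilinear_form V A z z" for z
  proof -
    have "bilinear_form V M z z = (\<Sum>u\<in>V. \<mu> * (z u)\<^sup>2 - z u * (\<Sum>v\<in>V. A u v * z v))"
      unfolding bilinear_form_def
      by (intro sum.cong) (simp_all add: M_apply right_diff_distrib power2_eq_square)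
    then show ?thesis by (simp add: sum_subtractf bilinear_form_def sum_distrib_left[symmetric])
  qed
  have "(\<Sum>v\<in>V. M u v * x v) = 0"
    using assms(1)
  proof (rule positive_semidefinite_isotropic_imp_kernel)
    show "M u v = M v u" if "u \<in> V" "v \<in> V" for u v using sym[OF that] by (simp add: M_def)
    show "0 \<le> bilinear_form V M z z" for z using Rayleigh_le[of z] by (simp add: form_M)
    show "bilinear_form V M x x = 0" by (simp add: form_M Rayleigh_eq)
  qed fact
  then show ?thesis using M_apply[OF \<open>u \<in> V\<close>, of x] by simp
qed

lemma nonneg_symmetric_matrix_Max_eigenvector:
  fixes A :: "'v \<Rightarrow> 'v \<Rightarrow> real"
  assumes finite_nonempty: "finite V" "V \<noteq> {}"
    and sym: "\<And>u v. u \<in> V \<Longrightarrow> v \<in> V \<Longrightarrow> A u v = A v u"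
    and nonneg: "\<And>u v. u \<in> V \<Longrightarrow> v \<in> V \<Longrightarrow> 0 \<le> A u v"
  obtains x where "\<And>v. v \<in> V \<Longrightarrow> 0 \<le> x v" "\<exists>v\<in>V. x v \<noteq> 0"
    "\<And>u. u \<in> V \<Longrightarrow> (\<Sum>v\<in>V. A u v * x v) = Max (matrix_eigenvalues V A) * x u"
proof -
  obtain x where x_in_sphere: "x \<in> nonneg_unit_sphere V"
    and Rayleigh_le: "\<And>z. bilinear_form V A z z \<le> bilinear_form V A x x * (\<Sum>v\<in>V. (z v)\<^sup>2)"
    using exists_nonneg_Rayleigh_maximizer[of V A] finite_nonempty nonneg by blast
  define \<mu> where "\<mu> = bilinear_form V A x x"
  have "bilinear_form V A x x = \<mu> * (\<Sum>v\<in>V. (x v)\<^sup>2)"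
    using x_in_sphere by (simp add: \<mu>_def nonneg_unit_sphere_def)
  then have eigen: "(\<Sum>v\<in>V. A u v * x v) = \<mu> * x u" if "u \<in> V" for u
    using Rayleigh_maximizer_imp_eigenvector[of V A] finite_nonempty(1) sym Rayleigh_le that
    unfolding \<mu>_def by blast
  have "\<exists>v\<in>V. x v \<noteq> 0"
    using x_in_sphere by (auto simp: nonneg_unit_sphere_def intro: ccontr)
  moreover have "Max (matrix_eigenvalues V A) = \<mu>"
  proof (rule Max_eqI[OF finite_matrix_eigenvalues[OF finite_nonempty(1)]])
    show "\<mu> \<in> matrix_eigenvalues V A"
      using eigen \<open>\<exists>v\<in>V. x v \<noteq> 0\<close> by (auto simp: matrix_eigenvalues_def)
    fix c assume "c \<in> matrix_eigenvalues V A"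
    then obtain z where eigenvector_z: "\<exists>v\<in>V. z v \<noteq> 0" "\<And>u. u \<in> V \<Longrightarrow> (\<Sum>v\<in>V. A u v * z v) = c * z u"
      by (auto simp: matrix_eigenvalues_def)
    then have "bilinear_form V A z z = c * (\<Sum>v\<in>V. (z v)\<^sup>2)"
      by (simp add: bilinear_form_def sum_distrib_left power2_eq_square mult_ac)
    moreover have "(\<Sum>v\<in>V. (z v)\<^sup>2) > 0"
      using eigenvector_z(1) finite_nonempty(1) by (auto intro: sum_pos2)
    ultimately show "c \<le> \<mu>" using Rayleigh_le[of z] by (simp add: \<mu>_def)
  qed
  ultimately show thesis using that[of x] eigen x_in_sphere by (simp add: nonneg_unit_sphere_def)
qed

section \<open>The Schur test\<close>

lemma ell2_norm_nonneg: "0 \<le> ell2_norm V f"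
  by (auto simp: ell2_norm_def intro: infsum_nonneg)

lemma finite_support_in_ell2:
  assumes "finite S" "S \<subseteq> V" "\<And>v. v \<in> V - S \<Longrightarrow> f v = 0"
  shows "f \<in> ell2 V" and "ell2_norm V f = L2_set (\<lambda>v. cmod (f v)) S"
proof -
  have "(\<lambda>v. (cmod (f v))\<^sup>2) summable_on V \<longleftrightarrow> (\<lambda>v. (cmod (f v))\<^sup>2) summable_on S"
    using assms by (intro summable_on_cong_neutral) auto
  then show "f \<in> ell2 V" using assms(1) by (simp add: ell2_def)
  have "(\<Sum>\<^sub>\<infinity>v\<in>V. (cmod (f v))\<^sup>2) = (\<Sum>\<^sub>\<infinity>v\<in>S. (cmod (f v))\<^sup>2)"
    using assms by (intro infsum_cong_neutral) auto
  then show "ell2_norm V f = L2_set (\<lambda>v. cmod (f v)) S"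
    using assms(1) by (simp add: ell2_norm_def L2_set_def)
qed

lemma ell2_norm_scale: "ell2_norm V (\<lambda>v. c * f v) = cmod c * ell2_norm V f"
  by (simp add: ell2_norm_def norm_mult power_mult_distrib infsum_cmult_right' real_sqrt_mult)

lemma ell2_scale: "f \<in> ell2 V \<Longrightarrow> (\<lambda>v. c * f v) \<in> ell2 V"
  by (simp add: ell2_def norm_mult power_mult_distrib summable_on_cmult_right)

lemma L2_set_le_ell2_norm:
  assumes "f \<in> ell2 V" "finite S" "S \<subseteq> V"
  shows "L2_set (\<lambda>v. cmod (f v)) S \<le> ell2_norm V f"
  unfolding L2_set_def ell2_norm_def
  using assms by (intro real_sqrt_le_mono finite_sum_le_infsum) (auto simp: ell2_def)

lemma ell2_if_L2_set_bounded:
  assumes "\<And>F. finite F \<Longrightarrow> F \<subseteq> V \<Longrightarrow> L2_set (\<lambda>v. cmod (f v)) F \<le> B"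
  shows "f \<in> ell2 V" and "ell2_norm V f \<le> B"
proof -
  have sum_le: "(\<Sum>v\<in>F. (cmod (f v))\<^sup>2) \<le> B\<^sup>2" if "finite F" "F \<subseteq> V" for F
    using assms[OF that] unfolding L2_set_def by (rule sqrt_le_D)
  then have summable: "(\<lambda>v. (cmod (f v))\<^sup>2) summable_on V"
    by (intro nonneg_bdd_above_summable_on) (auto intro!: bdd_aboveI2)
  then show "f \<in> ell2 V" by (simp add: ell2_def)
  have "(\<Sum>\<^sub>\<infinity>v\<in>V. (cmod (f v))\<^sup>2) \<le> B\<^sup>2"
    using summable sum_le by (intro infsum_le_finite_sums) auto
  moreover have "0 \<le> B" using assms[of "{}"] by simp
  ultimately show "ell2_norm V f \<le> B"
    unfolding ell2_norm_def by (intro real_le_lsqrt infsum_nonneg) auto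
qed

lemma (in pre_digraph) adjacency_op_scale:
  "adjacency_op G (\<lambda>v. c * f v) = (\<lambda>v. c * adjacency_op G f v)"
  by (simp add: adjacency_op_def sum_distrib_left fun_eq_iff)

lemma (in bidirected_digraph) sum_reversed_stars_le:
  assumes finite_F: "finite F" "F \<subseteq> verts G"
    and locally_finite: "\<And>v. v \<in> verts G \<Longrightarrow> finite (out_arcs G v)"
    and nonneg: "\<And>b. b \<in> arcs G \<Longrightarrow> 0 \<le> g b"
  shows "\<exists>H. finite H \<and> H \<subseteq> verts G \<and>
    (\<Sum>v\<in>F. \<Sum>a\<in>out_arcs G v. g (arev a)) \<le> (\<Sum>u\<in>H. \<Sum>b\<in>out_arcs G u. g b :: real)"
proof (intro exI conjI)
  let ?X = "\<Union>v\<in>F. out_arcs G v"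
  let ?H = "head G ` ?X"
  show finite_H: "finite ?H" "?H \<subseteq> verts G" using finite_F locally_finite by auto
  have "(\<Sum>v\<in>F. \<Sum>a\<in>out_arcs G v. g (arev a)) = (\<Sum>a\<in>?X. g (arev a))"
    using finite_F locally_finite by (subst sum.UNION_disjoint) auto
  also have "\<dots> = (\<Sum>b\<in>arev ` ?X. g b)"
    by (subst sum.reindex) (auto simp: o_def)
  also have "\<dots> \<le> (\<Sum>b\<in>(\<Union>u\<in>?H. out_arcs G u). g b)"
  proof (rule sum_mono2)
    show "finite (\<Union>u\<in>?H. out_arcs G u)"
      using finite_H locally_finite by (intro finite_UN_I) auto
    show "arev ` ?X \<subseteq> (\<Union>u\<in>?H. out_arcs G u)" by fastforce
    show "0 \<le> g b" if "b \<in> (\<Union>u\<in>?H. out_arcs G u) - arev ` ?X" for b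
      using that nonneg by auto
  qed
  also have "\<dots> = (\<Sum>u\<in>?H. \<Sum>b\<in>out_arcs G u. g b)"
    using finite_H locally_finite by (subst sum.UNION_disjoint) auto
  finally show "(\<Sum>v\<in>F. \<Sum>a\<in>out_arcs G v. g (arev a)) \<le> (\<Sum>u\<in>?H. \<Sum>b\<in>out_arcs G u. g b)" .
qed

locale schur_weights = bidirected_digraph G arev
  for G :: "('a, 'b) pre_digraph" and arev :: "'b \<Rightarrow> 'b" +
  fixes c :: "'b \<Rightarrow> real" and K :: real
  assumes verts_nonempty: "verts G \<noteq> {}"
    and locally_finite: "\<And>v. v \<in> verts G \<Longrightarrow> finite (out_arcs G v)"
    and weight_pos: "\<And>a. a \<in> arcs G \<Longrightarrow> 0 < c a"
    and weight_arev: "\<And>a. a \<in> arcs G \<Longrightarrow> c a * c (arev a) = 1"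
    and weight_sum: "\<And>v. v \<in> verts G \<Longrightarrow> (\<Sum>a\<in>out_arcs G v. c a) \<le> K"
begin

lemma bound_nonneg: "0 \<le> K"
proof -
  obtain v where "v \<in> verts G" using verts_nonempty by blast
  moreover have "0 \<le> (\<Sum>a\<in>out_arcs G v. c a)"
    using weight_pos by (intro sum_nonneg) (auto simp: less_imp_le)
  ultimately show ?thesis using weight_sum by fastforce
qed

lemma cmod_adjacency_op_square_le:
  assumes "v \<in> verts G"
  shows "(cmod (adjacency_op G f v))\<^sup>2 \<le>
    K * (\<Sum>a\<in>out_arcs G v. (cmod (f (head G a)))\<^sup>2 * c (arev a))"
proof -
  let ?O = "out_arcs G v" and ?h = "\<lambda>a. cmod (f (head G a)) * sqrt (c (arev a))"
  have "cmod (adjacency_op G f v) \<le> (\<Sum>a\<in>?O. cmod (f (head G a)))"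
    unfolding adjacency_op_def by (rule norm_sum)
  also have "\<dots> = (\<Sum>a\<in>?O. sqrt (c a) * ?h a)"
  proof (rule sum.cong)
    fix a assume "a \<in> ?O"
    then have "sqrt (c a) * sqrt (c (arev a)) = 1"
      using weight_arev[of a] real_sqrt_mult[of "c a" "c (arev a)"] by simp
    then show "cmod (f (head G a)) = sqrt (c a) * ?h a"
      by (simp add: mult.left_commute)
  qed simp
  finally have "(cmod (adjacency_op G f v))\<^sup>2 \<le> (\<Sum>a\<in>?O. sqrt (c a) * ?h a)\<^sup>2"
    by (intro power_mono) auto
  also have "\<dots> \<le> (\<Sum>a\<in>?O. (sqrt (c a))\<^sup>2) * (\<Sum>a\<in>?O. (?h a)\<^sup>2)"
    by (rule Cauchy_Schwarz_ineq_sum)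
  also have "\<dots> = (\<Sum>a\<in>?O. c a) * (\<Sum>a\<in>?O. (cmod (f (head G a)))\<^sup>2 * c (arev a))"
    using weight_pos
    by (intro arg_cong2[where f = "(*)"] sum.cong) (auto simp: power_mult_distrib less_imp_le)
  also have "\<dots> \<le> K * (\<Sum>a\<in>?O. (cmod (f (head G a)))\<^sup>2 * c (arev a))"
    using weight_sum[OF assms] weight_pos
    by (intro mult_right_mono sum_nonneg) (auto simp: less_imp_le)
  finally show ?thesis .
qed

lemma sum_weighted_stars_le:
  assumes f_in_ell2: "f \<in> ell2 (verts G)" and finite_H: "finite H" "H \<subseteq> verts G"
  shows "(\<Sum>u\<in>H. \<Sum>b\<in>out_arcs G u. (cmod (f (tail G b)))\<^sup>2 * c b) \<le>
    K * (ell2_norm (verts G) f)\<^sup>2"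
proof -
  have "(\<Sum>u\<in>H. \<Sum>b\<in>out_arcs G u. (cmod (f (tail G b)))\<^sup>2 * c b) =
      (\<Sum>u\<in>H. (cmod (f u))\<^sup>2 * (\<Sum>b\<in>out_arcs G u. c b))"
    by (simp add: sum_distrib_left)
  also have "\<dots> \<le> (\<Sum>u\<in>H. (cmod (f u))\<^sup>2 * K)"
    using finite_H weight_sum by (intro sum_mono mult_left_mono) auto
  also have "\<dots> = K * (L2_set (\<lambda>u. cmod (f u)) H)\<^sup>2"
    by (simp add: L2_set_def sum_nonneg sum_distrib_left mult.commute)
  also have "\<dots> \<le> K * (ell2_norm (verts G) f)\<^sup>2"
    using L2_set_le_ell2_norm[OF f_in_ell2 finite_H] bound_nonneg
    by (intro mult_left_mono power_mono) auto
  finally show ?thesis .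
qed

lemma L2_set_adjacency_op_le:
  assumes f_in_ell2: "f \<in> ell2 (verts G)" and finite_F: "finite F" "F \<subseteq> verts G"
  shows "L2_set (\<lambda>v. cmod (adjacency_op G f v)) F \<le> K * ell2_norm (verts G) f"
proof -
  let ?g = "\<lambda>b. (cmod (f (tail G b)))\<^sup>2 * c b"
  obtain H where finite_H: "finite H" "H \<subseteq> verts G"
    and reversed_le: "(\<Sum>v\<in>F. \<Sum>a\<in>out_arcs G v. ?g (arev a)) \<le> (\<Sum>u\<in>H. \<Sum>b\<in>out_arcs G u. ?g b)"
    using sum_reversed_stars_le[OF finite_F locally_finite, of ?g] weight_pos
    by (auto simp: less_imp_le)
  have "(\<Sum>v\<in>F. (cmod (adjacency_op G f v))\<^sup>2) \<le>
      (\<Sum>v\<in>F. K * (\<Sum>a\<in>out_arcs G v. ?g (arev a)))"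
  proof (rule sum_mono)
    fix v assume "v \<in> F"
    then show "(cmod (adjacency_op G f v))\<^sup>2 \<le> K * (\<Sum>a\<in>out_arcs G v. ?g (arev a))"
      using cmod_adjacency_op_square_le[of v f] finite_F(2) by auto
  qed
  also have "\<dots> \<le> K * (K * (ell2_norm (verts G) f)\<^sup>2)"
    unfolding sum_distrib_left[symmetric]
    using order.trans[OF reversed_le sum_weighted_stars_le[OF f_in_ell2 finite_H]] bound_nonneg
    by (rule mult_left_mono)
  also have "\<dots> = (K * ell2_norm (verts G) f)\<^sup>2" by (simp add: power2_eq_square mult_ac)
  finally have "(\<Sum>v\<in>F. (cmod (adjacency_op G f v))\<^sup>2) \<le> (K * ell2_norm (verts G) f)\<^sup>2" .
  then show ?thesis
    unfolding L2_set_def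
    using bound_nonneg ell2_norm_nonneg
    by (intro real_le_lsqrt sum_nonneg mult_nonneg_nonneg) auto
qed

lemma
  assumes "f \<in> ell2 (verts G)"
  shows adjacency_op_in_ell2: "adjacency_op G f \<in> ell2 (verts G)"
    and ell2_norm_adjacency_op_le:
      "ell2_norm (verts G) (adjacency_op G f) \<le> K * ell2_norm (verts G) f"
  by (rule ell2_if_L2_set_bounded[OF L2_set_adjacency_op_le[OF assms]]; assumption)+

lemma ell2_norm_adjacency_op_le_if_unit_ball:
  assumes "f \<in> ell2 (verts G)" "ell2_norm (verts G) f \<le> 1"
  shows "ell2_norm (verts G) (adjacency_op G f) \<le> K"
  using ell2_norm_adjacency_op_le[OF assms(1)] mult_left_mono[OF assms(2) bound_nonneg] by simp

lemma rho_le: "rho G \<le> K"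
  unfolding rho_def
proof (rule cSUP_least)
  have "(\<lambda>_. 0) \<in> {f \<in> ell2 (verts G). ell2_norm (verts G) f \<le> 1}"
    by (simp add: ell2_def ell2_norm_def)
  then show "{f \<in> ell2 (verts G). ell2_norm (verts G) f \<le> 1} \<noteq> {}" by blast
qed (simp add: ell2_norm_adjacency_op_le_if_unit_ball)

lemma ell2_norm_adjacency_op_le_rho:
  assumes f_in_ell2: "f \<in> ell2 (verts G)"
  shows "ell2_norm (verts G) (adjacency_op G f) \<le> rho G * ell2_norm (verts G) f"
proof (cases "ell2_norm (verts G) f = 0")
  case True
  then show ?thesis using ell2_norm_adjacency_op_le[OF f_in_ell2] by simp
next
  case False
  define t where "t = inverse (ell2_norm (verts G) f)"
  have scaling: "0 < t" "t * ell2_norm (verts G) f = 1"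
    using False ell2_norm_nonneg[of "verts G" f] by (auto simp: t_def)
  let ?g = "\<lambda>v. complex_of_real t * f v"
  have "bdd_above ((\<lambda>f. ell2_norm (verts G) (adjacency_op G f)) `
      {f \<in> ell2 (verts G). ell2_norm (verts G) f \<le> 1})"
    by (rule bdd_aboveI2[where M = K]) (simp add: ell2_norm_adjacency_op_le_if_unit_ball)
  moreover have "?g \<in> {f \<in> ell2 (verts G). ell2_norm (verts G) f \<le> 1}"
    using scaling f_in_ell2 by (simp add: ell2_norm_scale ell2_scale)
  ultimately have "ell2_norm (verts G) (adjacency_op G ?g) \<le> rho G"
    unfolding rho_def by (rule cSUP_upper[rotated])
  then have "t * ell2_norm (verts G) (adjacency_op G f) \<le> rho G"
    using scaling(1) by (simp add: adjacency_op_scale ell2_norm_scale)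
  then show ?thesis using scaling(1) by (simp add: t_def field_simps)
qed

lemma Rayleigh_quotient_le_rho:
  fixes y :: "'a \<Rightarrow> real"
  assumes finite_S: "finite S" "S \<subseteq> verts G"
  shows "(\<Sum>v\<in>S. y v * (\<Sum>a\<in>out_arcs G v. if head G a \<in> S then y (head G a) else 0)) \<le>
    rho G * (\<Sum>v\<in>S. (y v)\<^sup>2)"
proof -
  define g where "g v = (\<Sum>a\<in>out_arcs G v. if head G a \<in> S then y (head G a) else 0)" for v
  define f where "f v = (if v \<in> S then complex_of_real (y v) else 0)" for v
  have f_in_ell2: "f \<in> ell2 (verts G)" "ell2_norm (verts G) f = L2_set (\<lambda>v. cmod (f v)) S"
    using finite_support_in_ell2[OF finite_S, of f] by (simp_all add: f_def)
  have norm_f: "ell2_norm (verts G) f = L2_set y S"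
    unfolding f_in_ell2(2) by (simp add: L2_set_def f_def)
  have "adjacency_op G f v = complex_of_real (g v)" for v
    unfolding adjacency_op_def g_def of_real_sum by (intro sum.cong) (auto simp: f_def)
  then have "L2_set g S = L2_set (\<lambda>v. cmod (adjacency_op G f v)) S"
    by (simp add: L2_set_def)
  also have "\<dots> \<le> ell2_norm (verts G) (adjacency_op G f)"
    by (rule L2_set_le_ell2_norm[OF adjacency_op_in_ell2[OF f_in_ell2(1)] finite_S])
  also have "\<dots> \<le> rho G * L2_set y S"
    using ell2_norm_adjacency_op_le_rho[OF f_in_ell2(1)] by (simp add: norm_f)
  finally have g_le: "L2_set g S \<le> rho G * L2_set y S" .
  have "(\<Sum>v\<in>S. y v * g v) \<le> (\<Sum>v\<in>S. \<bar>y v\<bar> * \<bar>g v\<bar>)"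
    by (intro sum_mono) (simp add: abs_mult[symmetric])
  also have "\<dots> \<le> L2_set y S * L2_set g S" by (rule L2_set_mult_ineq)
  also have "\<dots> \<le> L2_set y S * (rho G * L2_set y S)" using g_le by (intro mult_left_mono) auto
  also have "\<dots> = rho G * (L2_set y S)\<^sup>2" by (simp add: power2_eq_square mult_ac)
  also have "(L2_set y S)\<^sup>2 = (\<Sum>v\<in>S. (y v)\<^sup>2)" by (simp add: L2_set_def sum_nonneg)
  finally show ?thesis by (simp add: g_def)
qed

end

section \<open>Positive eigenfunctions\<close>

locale positive_eigenfunction = bidirected_digraph G arev
  for G :: "('a, 'b) pre_digraph" and arev :: "'b \<Rightarrow> 'b" +
  fixes y :: "'a \<Rightarrow> real" and \<theta> :: real
  assumes nonempty: "verts G \<noteq> {}"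
    and finite_star: "\<And>v. v \<in> verts G \<Longrightarrow> finite (out_arcs G v)"
    and pos: "\<And>v. v \<in> verts G \<Longrightarrow> 0 < y v"
    and eigen: "\<And>v. v \<in> verts G \<Longrightarrow> (\<Sum>a\<in>out_arcs G v. y (head G a)) = \<theta> * y v"

sublocale positive_eigenfunction \<subseteq> schur_weights G arev "\<lambda>a. y (head G a) / y (tail G a)" \<theta>
proof
  show "0 < y (head G a) / y (tail G a)" if "a \<in> arcs G" for a
    using that pos by simp
  show "y (head G a) / y (tail G a) * (y (head G (arev a)) / y (tail G (arev a))) = 1"
    if "a \<in> arcs G" for a
    using pos[of "head G a"] pos[of "tail G a"] that by simp
  show "(\<Sum>a\<in>out_arcs G v. y (head G a) / y (tail G a)) \<le> \<theta>" if v_in_verts: "v \<in> verts G" for v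
  proof -
    have "(\<Sum>a\<in>out_arcs G v. y (head G a) / y (tail G a)) = (\<Sum>a\<in>out_arcs G v. y (head G a)) / y v"
      unfolding sum_divide_distrib by (intro sum.cong) auto
    then show ?thesis using eigen[OF v_in_verts] pos[OF v_in_verts] by simp
  qed
qed (use nonempty finite_star in auto)

lemma (in wf_digraph) sum_arc_boundary:
  assumes "finite S" and locally_finite: "\<And>v. v \<in> S \<Longrightarrow> finite (out_arcs G v)"
  shows "(\<Sum>a\<in>arc_boundary S. f a) =
    (\<Sum>v\<in>S. \<Sum>a\<in>out_arcs G v. if head G a \<in> S then 0 else f a)"
proof -
  let ?B = "\<lambda>v. {a \<in> out_arcs G v. head G a \<notin> S}"
  have arc_boundary_eq: "arc_boundary S = (\<Union>v\<in>S. ?B v)" by (auto simp: arc_boundary_def)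
  have "finite (?B v)" if "v \<in> S" for v
    using locally_finite[OF that] by (rule rev_finite_subset) blast
  then have "(\<Sum>a\<in>arc_boundary S. f a) = (\<Sum>v\<in>S. \<Sum>a\<in>?B v. f a)"
    unfolding arc_boundary_eq using assms(1) by (intro sum.UNION_disjoint) auto
  also have "\<dots> = (\<Sum>v\<in>S. \<Sum>a\<in>out_arcs G v. if head G a \<in> S then 0 else f a)"
  proof (rule sum.cong)
    fix v assume "v \<in> S"
    then have "(\<Sum>a\<in>?B v. f a) = (\<Sum>a\<in>out_arcs G v. if head G a \<notin> S then f a else 0)"
      by (intro sum.inter_filter locally_finite)
    also have "\<dots> = (\<Sum>a\<in>out_arcs G v. if head G a \<in> S then 0 else f a)"
      by (intro sum.cong) auto
    finally show "(\<Sum>a\<in>?B v. f a) = (\<Sum>a\<in>out_arcs G v. if head G a \<in> S then 0 else f a)" .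
  qed simp
  finally show ?thesis .
qed

context positive_eigenfunction begin

lemma spectral_gap_le_arc_boundary:
  assumes finite_S: "finite S" "S \<subseteq> verts G"
  shows "(\<theta> - rho G) * (\<Sum>v\<in>S. (y v)\<^sup>2) \<le> (\<Sum>a\<in>arc_boundary S. y (tail G a) * y (head G a))"
proof -
  let ?inside = "\<lambda>v. \<Sum>a\<in>out_arcs G v. if head G a \<in> S then y (head G a) else 0"
  let ?outside = "\<lambda>v. \<Sum>a\<in>out_arcs G v. if head G a \<in> S then 0 else y (tail G a) * y (head G a)"
  have "\<theta> * (y v)\<^sup>2 = y v * ?inside v + ?outside v" if v_in_S: "v \<in> S" for v
  proof -
    have "\<theta> * (y v)\<^sup>2 = (\<Sum>a\<in>out_arcs G v. y v * y (head G a))"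
      using eigen[of v] v_in_S finite_S(2)
      by (auto simp: sum_distrib_left[symmetric] power2_eq_square)
    also have "\<dots> = y v * ?inside v + ?outside v"
      unfolding sum_distrib_left sum.distrib[symmetric] by (intro sum.cong) auto
    finally show ?thesis .
  qed
  then have "\<theta> * (\<Sum>v\<in>S. (y v)\<^sup>2) = (\<Sum>v\<in>S. y v * ?inside v) + (\<Sum>v\<in>S. ?outside v)"
    by (simp add: sum_distrib_left sum.distrib)
  also have "(\<Sum>v\<in>S. y v * ?inside v) \<le> rho G * (\<Sum>v\<in>S. (y v)\<^sup>2)"
    by (rule Rayleigh_quotient_le_rho[OF finite_S])
  also have "(\<Sum>v\<in>S. ?outside v) = (\<Sum>a\<in>arc_boundary S. y (tail G a) * y (head G a))"
    using finite_S finite_star by (intro sum_arc_boundary[symmetric]) auto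
  finally show ?thesis by (simp add: left_diff_distrib)
qed

lemma spectral_gap_mult_card_le:
  assumes finite_S: "finite S" "S \<subseteq> verts G" and gap: "rho G \<le> \<theta>"
    and bounds: "0 \<le> m" "\<And>v. v \<in> verts G \<Longrightarrow> m \<le> y v" "\<And>v. v \<in> verts G \<Longrightarrow> y v \<le> M"
  shows "(\<theta> - rho G) * m\<^sup>2 * card S \<le> M\<^sup>2 * card (arc_boundary S)"
proof -
  have "m\<^sup>2 \<le> (y v)\<^sup>2" if "v \<in> S" for v
    using bounds(1,2) finite_S(2) that by (intro power_mono) auto
  then have "m\<^sup>2 * card S \<le> (\<Sum>v\<in>S. (y v)\<^sup>2)"
    using sum_bounded_below[of S "m\<^sup>2" "\<lambda>v. (y v)\<^sup>2"] by (simp add: mult.commute)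
  then have "(\<theta> - rho G) * (m\<^sup>2 * card S) \<le> (\<theta> - rho G) * (\<Sum>v\<in>S. (y v)\<^sup>2)"
    using gap by (intro mult_left_mono) auto
  also have "\<dots> \<le> (\<Sum>a\<in>arc_boundary S. y (tail G a) * y (head G a))"
    by (rule spectral_gap_le_arc_boundary[OF finite_S])
  also have "\<dots> \<le> card (arc_boundary S) * M\<^sup>2"
  proof (rule sum_bounded_above)
    fix a assume "a \<in> arc_boundary S"
    then have ends_in_verts: "tail G a \<in> verts G" "head G a \<in> verts G"
      by (auto simp: arc_boundary_def)
    moreover have "0 \<le> M" using order.trans[OF less_imp_le[OF pos] bounds(3)] ends_in_verts by blast
    ultimately have "y (tail G a) * y (head G a) \<le> M * M"
      using bounds(3) pos by (intro mult_mono) (auto simp: less_imp_le)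
    then show "y (tail G a) * y (head G a) \<le> M\<^sup>2" by (simp add: power2_eq_square)
  qed
  finally show ?thesis by (simp add: mult_ac)
qed

lemma eigenvalue_eq_rho_if_Foelner:
  assumes bounds: "0 < m" "\<And>v. v \<in> verts G \<Longrightarrow> m \<le> y v" "\<And>v. v \<in> verts G \<Longrightarrow> y v \<le> M"
    and Foelner: "\<And>\<epsilon>. 0 < \<epsilon> \<Longrightarrow> \<exists>S\<subseteq>verts G. finite S \<and>
      real (card (arc_boundary S)) < \<epsilon> * real (card S)"
  shows "\<theta> = rho G"
proof (rule antisym[OF _ rho_le], rule ccontr)
  assume "\<not> \<theta> \<le> rho G"
  then have gap: "0 < \<theta> - rho G" by simp
  obtain v where "v \<in> verts G" using nonempty by blast
  then have M_pos: "0 < M" using bounds(1) bounds(2,3)[of v] by linarith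
  have "0 < (\<theta> - rho G) * m\<^sup>2 / M\<^sup>2" using gap bounds(1) M_pos by simp
  from Foelner[OF this] obtain S where finite_S: "S \<subseteq> verts G" "finite S"
    and "card (arc_boundary S) < (\<theta> - rho G) * m\<^sup>2 / M\<^sup>2 * card S"
    by blast
  then have "M\<^sup>2 * card (arc_boundary S) < (\<theta> - rho G) * m\<^sup>2 * card S"
    using M_pos by (simp add: field_simps)
  then show False
    using spectral_gap_mult_card_le[OF finite_S(2,1) _ _ bounds(2,3)] gap bounds(1) by force
qed

end

lemma (in fin_digraph) sum_adjacency_matrix:
  assumes "u \<in> verts G"
  shows "(\<Sum>v\<in>verts G. adjacency_matrix G u v * x v) = (\<Sum>a\<in>out_arcs G u. x (head G a))"
proof -
  have entry_eq: "adjacency_matrix G u v * x v =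
      (\<Sum>a\<in>{a \<in> out_arcs G u. head G a = v}. x (head G a))" for v
  proof -
    have "{a \<in> out_arcs G u. head G a = v} = {a \<in> arcs G. tail G a = u \<and> head G a = v}" by auto
    then show ?thesis by (simp add: adjacency_matrix_def)
  qed
  have "(\<Sum>v\<in>verts G. adjacency_matrix G u v * x v) =
      (\<Sum>v\<in>verts G. \<Sum>a\<in>{a \<in> out_arcs G u. head G a = v}. x (head G a))"
    by (simp only: entry_eq)
  also have "\<dots> = (\<Sum>a\<in>out_arcs G u. x (head G a))"
    by (rule sum.group) auto
  finally show ?thesis .
qed

context bidirected_digraph begin

lemma adjacency_matrix_commute: "adjacency_matrix G u v = adjacency_matrix G v u"
proof -
  have "bij_betw arev {a \<in> arcs G. tail G a = u \<and> head G a = v}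
      {a \<in> arcs G. tail G a = v \<and> head G a = u}"
    by (rule bij_betw_byWitness[where f' = arev]) auto
  then show ?thesis by (simp add: adjacency_matrix_def bij_betw_same_card)
qed

lemma nonneg_eigenfunction_pos:
  fixes x :: "'a \<Rightarrow> real"
  assumes "Digraph_Component.connected G"
    and locally_finite: "\<And>v. v \<in> verts G \<Longrightarrow> finite (out_arcs G v)"
    and nonneg: "\<And>v. v \<in> verts G \<Longrightarrow> 0 \<le> x v" and nonzero: "\<exists>v\<in>verts G. x v \<noteq> 0"
    and eigen: "\<And>v. v \<in> verts G \<Longrightarrow> (\<Sum>a\<in>out_arcs G v. x (head G a)) = \<theta> * x v"
    and "v \<in> verts G"
  shows "0 < x v"
proof (rule ccontr)
  assume "\<not> 0 < x v"
  let ?U = "{u \<in> verts G. x u = 0}"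
  have "?U \<noteq> {}" "?U \<noteq> verts G"
    using \<open>\<not> 0 < x v\<close> nonneg[OF \<open>v \<in> verts G\<close>] \<open>v \<in> verts G\<close> nonzero by force+
  then obtain a where leaving: "a \<in> arcs G" "tail G a \<in> ?U" "head G a \<notin> ?U"
    using connectingD[OF connected_imp_connecting_arcs[OF assms(1)], of ?U] by blast
  then have "(\<Sum>b\<in>out_arcs G (tail G a). x (head G b)) = 0"
    using eigen[of "tail G a"] by simp
  then have "x (head G a) = 0"
    using leaving locally_finite nonneg by (subst (asm) sum_nonneg_eq_0_iff) auto
  then show False using leaving by simp
qed

lemma exists_Perron_eigenfunction:
  assumes "fin_digraph G" "Digraph_Component.connected G"
  shows "\<exists>x. positive_eigenfunction G arev x (lambda1 G)"
proof -
  interpret fin_digraph G by fact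
  have "verts G \<noteq> {}" using assms(2) by (simp add: connected_conv)
  then obtain x where nonneg_nonzero: "\<And>v. v \<in> verts G \<Longrightarrow> 0 \<le> x v" "\<exists>v\<in>verts G. x v \<noteq> 0"
    and "\<And>u. u \<in> verts G \<Longrightarrow> (\<Sum>v\<in>verts G. adjacency_matrix G u v * x v) = lambda1 G * x u"
    unfolding lambda1_def
    using nonneg_symmetric_matrix_Max_eigenvector[of "verts G" "adjacency_matrix G"]
      adjacency_matrix_commute by (auto simp: adjacency_matrix_def)
  then have eigen: "(\<Sum>a\<in>out_arcs G v. x (head G a)) = lambda1 G * x v" if "v \<in> verts G" for v
    using that by (simp add: sum_adjacency_matrix)
  have "positive_eigenfunction G arev x (lambda1 G)"
  proof
    show "0 < x v" if "v \<in> verts G" for v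
      using nonneg_eigenfunction_pos[OF assms(2) _ nonneg_nonzero eigen that] by blast
  qed (use \<open>verts G \<noteq> {}\<close> eigen in auto)
  then show ?thesis by blast
qed

end

section \<open>Feedback edges\<close>

context bidirected_digraph begin

definition feedback_edge :: "'b \<Rightarrow> bool" where
  "feedback_edge a \<longleftrightarrow> (\<forall>q. undirected_cycle q \<longrightarrow> set q \<inter> edge a \<noteq> {})"

lemma exists_feedback_edge:
  assumes "at_most_one_cycle G arev"
  shows "\<exists>a. feedback_edge a"
proof (cases "\<exists>p. undirected_cycle p")
  case True
  then obtain p where cycle_p: "undirected_cycle p" by blast
  then have hd_in_p: "hd p \<in> set p" by (auto simp: undirected_cycle_def cycle_def)
  have "set q \<inter> edge (hd p) \<noteq> {}" if "undirected_cycle q" for q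
  proof -
    have "edge ` set p = edge ` set q"
      using assms cycle_p that unfolding at_most_one_cycle_def cycles_eq by blast
    then obtain b where "b \<in> set q" "edge (hd p) = edge b" using hd_in_p by blast
    then show ?thesis by (auto simp: edge_eq_iff)
  qed
  then show ?thesis by (auto simp: feedback_edge_def)
qed (simp add: feedback_edge_def)

lemma reduced_closed_awalk_avoiding_feedback_edge:
  assumes "feedback_edge a" "awalk u p u" "reduced p" "set p \<inter> edge a = {}"
  shows "p = []"
  using reduced_closed_awalk_contains_cycle[OF assms(2,3)] assms(1,4)
  by (fastforce simp: feedback_edge_def)

lemma reduced_awalk_crosses_feedback_edge_one_way:
  assumes "feedback_edge a" "awalk u p v" "reduced p"
  shows "a \<notin> set p \<or> arev a \<notin> set p"
proof (rule ccontr)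
  assume "\<not> ?thesis"
  then have both_directions: "a \<in> set p" "arev a \<in> set p" by blast+
  then have "a \<in> arcs G" using assms(2) by auto
  then obtain q e m q' where p_split: "p = q @ e # m @ arev e # q'"
    and m_avoids: "set m \<inter> edge a = {}"
    using split_between_edge_reversal both_directions by metis
  have "awalk (head G e) m (head G e)" using assms(2) by (auto simp: p_split awalk_simps)
  moreover have "reduced m"
    using assms(3) by (auto simp: p_split reduced_append_iff reduced_Cons_iff)
  ultimately have "m = []"
    using reduced_closed_awalk_avoiding_feedback_edge assms(1) m_avoids by blast
  then show False using assms(3) by (simp add: p_split reduced_append_iff reduced_Cons_iff)
qed

definition net_crossings :: "'b \<Rightarrow> 'b awalk \<Rightarrow> int" where
  "net_crossings a p = int (count_list p a) - int (count_list p (arev a))"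

lemma net_crossings_Nil [simp]: "net_crossings a [] = 0"
  by (simp add: net_crossings_def)

lemma net_crossings_append: "net_crossings a (p @ q) = net_crossings a p + net_crossings a q"
  by (simp add: net_crossings_def)

lemma net_crossings_arev: "net_crossings a [arev b] = - net_crossings a [b]"
proof -
  have "arev b = a \<longleftrightarrow> b = arev a" by auto
  then show ?thesis by (simp add: net_crossings_def arev_eq_iff)
qed

lemma reduced_closed_awalk_Nil_if_net_crossings_0:
  assumes "feedback_edge a" "awalk u p u" "reduced p" "net_crossings a p = 0"
  shows "p = []"
proof -
  have "count_list p a = count_list p (arev a)" using assms(4) by (simp add: net_crossings_def)
  then have "set p \<inter> edge a = {}"
    using reduced_awalk_crosses_feedback_edge_one_way[OF assms(1-3)]
    by (auto simp: edge_def count_list_0_iff[symmetric])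
  then show ?thesis
    by (rule reduced_closed_awalk_avoiding_feedback_edge[OF assms(1-3)])
qed

end

section \<open>Rooted trees\<close>

locale rooted_tree = bidirected_digraph G arev
  for G :: "('a, 'b) pre_digraph" and arev :: "'b \<Rightarrow> 'b" +
  fixes root :: 'a
  assumes connected: "Digraph_Component.connected G"
    and acyclic: "cycles G arev = {}"
    and root: "root \<in> verts G"
begin

definition root_path :: "'a \<Rightarrow> 'b awalk" where
  "root_path v = (THE p. awalk root p v \<and> reduced p)"

lemma root_path_eqI:
  assumes "awalk root p v" "reduced p"
  shows "root_path v = p"
  unfolding root_path_def
  using assms reduced_awalk_unique[OF acyclic] by (intro the_equality) auto

lemma
  assumes "v \<in> verts G"
  shows awalk_root_path: "awalk root (root_path v) v" and reduced_root_path: "reduced (root_path v)"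
proof -
  obtain p where "apath root p v" using connected_imp_apath[OF connected root assms] by blast
  then have "awalk root p v" "reduced p" by (simp_all add: awalkI_apath apath_imp_reduced)
  then show "awalk root (root_path v) v" "reduced (root_path v)" by (simp_all add: root_path_eqI)
qed

lemma root_path_root: "root_path root = []"
  using root by (intro root_path_eqI) (simp_all add: awalk_Nil_iff)

lemma root_path_step:
  assumes "a \<in> arcs G"
  shows "root_path (head G a) = root_path (tail G a) @ [a] \<or>
    root_path (tail G a) = root_path (head G a) @ [arev a]"
proof (cases "reduced (root_path (tail G a) @ [a])")
  case True
  have "awalk root (root_path (tail G a) @ [a]) (head G a)"
    using awalk_root_path[of "tail G a"] assms by (auto simp: awalk_simps)
  then show ?thesis using root_path_eqI True by blast
next
  case False
  have reduced: "reduced (root_path (tail G a))" using reduced_root_path assms by simp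
  then have "root_path (tail G a) \<noteq> []" "a = arev (last (root_path (tail G a)))"
    using False by (auto simp: reduced_append_iff reduced_Cons_iff)
  then obtain p where path_split: "root_path (tail G a) = p @ [arev a]"
    by (metis append_butlast_last_id arev_arev)
  have "awalk root (p @ [arev a]) (tail G a)"
    using awalk_root_path[of "tail G a"] assms path_split by simp
  then have "awalk root p (head G a)" using assms by (auto simp: awalk_simps)
  moreover have "reduced p" using reduced path_split by (simp add: reduced_append_iff)
  ultimately have "root_path (head G a) = p" by (rule root_path_eqI)
  then show ?thesis using path_split by simp
qed

definition away :: "'b \<Rightarrow> bool" where
  "away a \<longleftrightarrow> root_path (head G a) = root_path (tail G a) @ [a]"

lemma away_arev:
  assumes "a \<in> arcs G"
  shows "away (arev a) \<longleftrightarrow> \<not> away a"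
proof
  assume "away (arev a)"
  then have "length (root_path (tail G a)) = Suc (length (root_path (head G a)))"
    using assms by (simp add: away_def)
  then show "\<not> away a" by (auto simp: away_def)
next
  assume "\<not> away a"
  then show "away (arev a)" using root_path_step[OF assms] assms by (simp add: away_def)
qed

lemma away_if_tail_root:
  assumes "a \<in> out_arcs G root"
  shows "away a"
  using root_path_step[of a] assms by (auto simp: away_def root_path_root)

lemma unique_arc_towards_root:
  assumes "v \<in> verts G" "v \<noteq> root"
  obtains b where "b \<in> out_arcs G v" "\<not> away b" "\<And>a. a \<in> out_arcs G v - {b} \<Longrightarrow> away a"
proof -
  have "root_path v \<noteq> []"
    using awalk_root_path[OF assms(1)] assms(2) by (auto simp: awalk_Nil_iff)
  then obtain p e where path_split: "root_path v = p @ [e]" by (metis append_butlast_last_id)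
  have last_arc: "e \<in> arcs G" "head G e = v" "awalk root p (tail G e)"
    using awalk_root_path[OF assms(1)] unfolding path_split by (auto simp: awalk_simps)
  moreover have "reduced p"
    using reduced_root_path[OF assms(1)] unfolding path_split by (simp add: reduced_append_iff)
  ultimately have "away e" using path_split by (simp add: away_def root_path_eqI)
  moreover have "away a" if "a \<in> out_arcs G v - {arev e}" for a
  proof (rule ccontr)
    assume "\<not> away a"
    then have "root_path v = root_path (head G a) @ [arev a]"
      using root_path_step[of a] that by (auto simp: away_def)
    then have "arev a = e" using path_split by simp
    then show False using that by auto
  qed
  ultimately show thesis
    using last_arc away_arev[of e] by (intro that[of "arev e"]) auto
qed

end

section \<open>Covers by trees\<close>

text \<open>
  Arcs of a tree cover leading away from the root get the weight \<open>\<phi>\<close> of their projection, arcs leading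
  back the inverse weight of their reversal. The last expression is then the star sum at a vertex
  that is reached from the root through an arc over \<open>b\<close>.
\<close>

definition (in bidirected_digraph) outward_weights :: "('b \<Rightarrow> real) \<Rightarrow> real \<Rightarrow> bool" where
  "outward_weights \<phi> K \<longleftrightarrow> (\<forall>b\<in>arcs G. 0 < \<phi> b) \<and>
     (\<forall>v\<in>verts G. (\<Sum>a\<in>out_arcs G v. \<phi> a) \<le> K) \<and>
     (\<forall>b\<in>arcs G. 1 / \<phi> b - \<phi> (arev b) + (\<Sum>a\<in>out_arcs G (head G b). \<phi> a) \<le> K)"

locale tree_cover = G: bidirected_digraph G r + G: fin_digraph G + T: rooted_tree T s root
  for G :: "('v, 'e) pre_digraph" and r :: "'e \<Rightarrow> 'e"
    and T :: "('w, 'f) pre_digraph" and s :: "'f \<Rightarrow> 'f" and root :: 'w +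
  fixes \<pi>v :: "'w \<Rightarrow> 'v" and \<pi>e :: "'f \<Rightarrow> 'e"
  assumes hom: "graph_hom T s G r \<pi>v \<pi>e"
    and star: "\<And>v. v \<in> verts T \<Longrightarrow> bij_betw \<pi>e (out_arcs T v) (out_arcs G (\<pi>v v))"

lemma universal_cover_imp_tree_cover:
  assumes "bidirected_digraph G r" "fin_digraph G" "is_universal_cover T s G r"
  obtains root \<pi>v \<pi>e where "tree_cover G r T s root \<pi>v \<pi>e"
proof -
  obtain \<pi>v \<pi>e where tree_T: "bidirected_digraph T s" "Digraph_Component.connected T"
      "cycles T s = {}"
    and "graph_hom T s G r \<pi>v \<pi>e"
      "\<forall>v\<in>verts T. bij_betw \<pi>e (out_arcs T v) (out_arcs G (\<pi>v v))"
    using assms(3) unfolding is_universal_cover_def is_tree_def by blast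
  moreover interpret T: bidirected_digraph T s by fact
  obtain root where "root \<in> verts T" using tree_T(2) by (auto simp: connected_conv)
  ultimately have "tree_cover G r T s root \<pi>v \<pi>e"
    using assms(1,2)
    by (intro tree_cover.intro rooted_tree.intro rooted_tree_axioms.intro tree_cover_axioms.intro)
      auto
  then show thesis by (rule that)
qed

context tree_cover begin

lemma \<pi>v_in_verts: "v \<in> verts T \<Longrightarrow> \<pi>v v \<in> verts G"
  using hom by (simp add: graph_hom_def)

lemma
  assumes "a \<in> arcs T"
  shows \<pi>e_in_arcs: "\<pi>e a \<in> arcs G"
    and tail_\<pi>e: "tail G (\<pi>e a) = \<pi>v (tail T a)"
    and head_\<pi>e: "head G (\<pi>e a) = \<pi>v (head T a)"
    and \<pi>e_arev: "\<pi>e (s a) = r (\<pi>e a)"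
  using hom assms by (auto simp: graph_hom_def)

lemma finite_out_arcs_cover: "v \<in> verts T \<Longrightarrow> finite (out_arcs T v)"
  using bij_betw_finite[OF star] by blast

lemma \<pi>e_eq_iff:
  assumes "a \<in> arcs T" "b \<in> arcs T" "tail T a = tail T b"
  shows "\<pi>e a = \<pi>e b \<longleftrightarrow> a = b"
  using bij_betw_imp_inj_on[OF star[of "tail T a"]] assms by (auto simp: inj_on_def)

lemma sum_star:
  "v \<in> verts T \<Longrightarrow> (\<Sum>a\<in>out_arcs T v. f (\<pi>e a)) = (\<Sum>a\<in>out_arcs G (\<pi>v v). f a)"
  by (rule sum.reindex_bij_betw[OF star])

lemma awalk_project: "T.awalk u p v \<Longrightarrow> G.awalk (\<pi>v u) (map \<pi>e p) (\<pi>v v)"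
  by (induction p arbitrary: u)
    (auto simp: T.awalk_simps G.awalk_simps \<pi>v_in_verts \<pi>e_in_arcs tail_\<pi>e head_\<pi>e)

lemma reduced_project: "T.awalk u p v \<Longrightarrow> T.reduced p \<Longrightarrow> G.reduced (map \<pi>e p)"
proof (induction p arbitrary: u)
  case (Cons a p)
  have "hd (map \<pi>e p) \<noteq> r (\<pi>e a)" if "p \<noteq> []"
  proof -
    have "a \<in> arcs T" "hd p \<in> arcs T" "tail T (hd p) = head T a" "hd p \<noteq> s a"
      using Cons.prems that by (cases p; auto simp: T.awalk_Cons_iff T.reduced_Cons_iff)+
    then show ?thesis using that \<pi>e_eq_iff[of "hd p" "s a"] by (simp add: hd_map \<pi>e_arev)
  qed
  then show ?case
    using Cons by (auto simp: T.awalk_Cons_iff T.reduced_Cons_iff G.reduced_Cons_iff)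
qed simp

lemma positive_eigenfunction_lift:
  assumes "positive_eigenfunction G r x \<theta>"
  shows "positive_eigenfunction T s (\<lambda>v. x (\<pi>v v)) \<theta>"
proof -
  interpret x: positive_eigenfunction G r x \<theta> by fact
  show ?thesis
  proof
    fix v assume v_in_verts: "v \<in> verts T"
    then show "0 < x (\<pi>v v)" by (simp add: x.pos \<pi>v_in_verts)
    have "(\<Sum>a\<in>out_arcs T v. x (\<pi>v (head T a))) = (\<Sum>a\<in>out_arcs T v. x (head G (\<pi>e a)))"
      by (intro sum.cong) (auto simp: head_\<pi>e)
    also have "\<dots> = \<theta> * x (\<pi>v v)"
      using sum_star[OF v_in_verts, of "\<lambda>a. x (head G a)"] x.eigen[OF \<pi>v_in_verts[OF v_in_verts]]
      by simp
    finally show "(\<Sum>a\<in>out_arcs T v. x (\<pi>v (head T a))) = \<theta> * x (\<pi>v v)" .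
  qed (use T.root finite_out_arcs_cover in auto)
qed

definition outward_lift :: "('e \<Rightarrow> real) \<Rightarrow> 'f \<Rightarrow> real" where
  "outward_lift \<phi> a = (if T.away a then \<phi> (\<pi>e a) else 1 / \<phi> (\<pi>e (s a)))"

lemma sum_outward_lift_le:
  assumes weights: "G.outward_weights \<phi> K" and v_in_verts: "v \<in> verts T"
  shows "(\<Sum>a\<in>out_arcs T v. outward_lift \<phi> a) \<le> K"
proof (cases "v = root")
  case True
  then have "(\<Sum>a\<in>out_arcs T v. outward_lift \<phi> a) = (\<Sum>a\<in>out_arcs T v. \<phi> (\<pi>e a))"
    using T.away_if_tail_root by (intro sum.cong) (auto simp: outward_lift_def)
  then show ?thesis
    using sum_star[OF v_in_verts, of \<phi>] weights \<pi>v_in_verts[OF v_in_verts]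
    by (simp add: G.outward_weights_def)
next
  case False
  then obtain b where towards_root: "b \<in> out_arcs T v" "\<not> T.away b"
    "\<And>a. a \<in> out_arcs T v - {b} \<Longrightarrow> T.away a"
    using T.unique_arc_towards_root[OF v_in_verts] by blast
  let ?e = "\<pi>e (s b)"
  have entering_arc: "?e \<in> arcs G" "head G ?e = \<pi>v v" "r ?e = \<pi>e b"
    using towards_root(1) by (auto simp: \<pi>e_in_arcs tail_\<pi>e head_\<pi>e \<pi>e_arev)
  note finite_star = finite_out_arcs_cover[OF v_in_verts]
  have "(\<Sum>a\<in>out_arcs T v. outward_lift \<phi> a) =
      outward_lift \<phi> b + (\<Sum>a\<in>out_arcs T v - {b}. outward_lift \<phi> a)"
    by (rule sum.remove[OF finite_star towards_root(1)])
  also have "outward_lift \<phi> b = 1 / \<phi> ?e" using towards_root(2) by (simp add: outward_lift_def)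
  also have "(\<Sum>a\<in>out_arcs T v - {b}. outward_lift \<phi> a) = (\<Sum>a\<in>out_arcs T v - {b}. \<phi> (\<pi>e a))"
    using towards_root(3) by (intro sum.cong) (auto simp: outward_lift_def)
  also have "\<dots> = (\<Sum>a\<in>out_arcs G (head G ?e). \<phi> a) - \<phi> (r ?e)"
    using sum.remove[OF finite_star towards_root(1), of "\<lambda>a. \<phi> (\<pi>e a)"]
    by (simp add: sum_star[OF v_in_verts] entering_arc)
  also have "1 / \<phi> ?e + \<dots> \<le> K"
    using weights entering_arc(1) by (auto simp: G.outward_weights_def algebra_simps)
  finally show ?thesis .
qed

lemma schur_weights_outward_lift:
  assumes weights: "G.outward_weights \<phi> K"
  shows "schur_weights T s (outward_lift \<phi>) K"
proof
  have \<phi>_pos: "0 < \<phi> (\<pi>e a)" if "a \<in> arcs T" for a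
    using weights \<pi>e_in_arcs[OF that] by (simp add: G.outward_weights_def)
  show "0 < outward_lift \<phi> a" if "a \<in> arcs T" for a
    using that \<phi>_pos by (simp add: outward_lift_def)
  show "outward_lift \<phi> a * outward_lift \<phi> (s a) = 1" if "a \<in> arcs T" for a
    using \<phi>_pos[OF that] \<phi>_pos[of "s a"] T.away_arev[OF that] that
    by (simp add: outward_lift_def)
qed (use T.root finite_out_arcs_cover sum_outward_lift_le[OF weights] in auto)

lemma rho_le_if_outward_weights:
  assumes "G.outward_weights \<phi> K"
  shows "rho T \<le> K"
  by (rule schur_weights.rho_le[OF schur_weights_outward_lift[OF assms]])

definition height :: "'e \<Rightarrow> 'w \<Rightarrow> int" where
  "height e v = G.net_crossings e (map \<pi>e (T.root_path v))"

definition slab :: "'e \<Rightarrow> nat \<Rightarrow> 'w set" where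
  "slab e n = {v \<in> verts T. \<bar>height e v\<bar> \<le> int n}"

lemma height_step:
  assumes "a \<in> arcs T"
  shows "height e (head T a) = height e (tail T a) + G.net_crossings e [\<pi>e a]"
  using T.root_path_step[OF assms]
  by (auto simp: height_def G.net_crossings_append \<pi>e_arev[OF assms] G.net_crossings_arev)

lemma height_awalk:
  "T.awalk u p v \<Longrightarrow> height e v = height e u + G.net_crossings e (map \<pi>e p)"
proof (induction p arbitrary: u)
  case (Cons a p)
  then have "a \<in> arcs T" "u = tail T a" "T.awalk (head T a) p v" by (auto simp: T.awalk_Cons_iff)
  then show ?case
    using Cons.IH height_step G.net_crossings_append[of e "[\<pi>e a]" "map \<pi>e p"] by simp
qed (simp add: T.awalk_Nil_iff)

lemma finite_subset_slab:
  assumes "finite F" "F \<subseteq> verts T"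
  obtains n where "F \<subseteq> slab e n"
proof
  have "nat \<bar>height e v\<bar> \<le> (\<Sum>v\<in>F. nat \<bar>height e v\<bar>)" if "v \<in> F" for v
    using assms(1) that by (intro member_le_sum) auto
  then show "F \<subseteq> slab e (\<Sum>v\<in>F. nat \<bar>height e v\<bar>)"
    using assms(2) by (auto simp: slab_def nat_le_iff)
qed

context
  fixes e assumes feedback: "G.feedback_edge e"
begin

lemma vertex_determined_by_height:
  assumes "u \<in> verts T" "v \<in> verts T" "\<pi>v u = \<pi>v v" "height e u = height e v"
  shows "u = v"
proof -
  obtain p where "T.apath u p v"
    using T.connected_imp_apath[OF T.connected assms(1,2)] by blast
  then have walk: "T.awalk u p v" "T.reduced p"
    by (simp_all add: T.awalkI_apath T.apath_imp_reduced)
  have "G.net_crossings e (map \<pi>e p) = 0"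
    using height_awalk[OF walk(1)] assms(4) by simp
  then have "map \<pi>e p = []"
    using G.reduced_closed_awalk_Nil_if_net_crossings_0[OF feedback _ reduced_project[OF walk]]
      awalk_project[OF walk(1)] assms(3) by simp
  then show ?thesis using walk(1) by (simp add: T.awalk_Nil_iff)
qed

lemma finite_slab: "finite (slab e n)"
proof (rule inj_on_finite)
  show "inj_on (\<lambda>v. (\<pi>v v, height e v)) (slab e n)"
    by (auto simp: inj_on_def slab_def intro: vertex_determined_by_height)
  show "(\<lambda>v. (\<pi>v v, height e v)) ` slab e n \<subseteq> verts G \<times> {- int n..int n}"
    using \<pi>v_in_verts by (auto simp: slab_def)
qed auto

lemma card_arc_boundary_slab: "card (T.arc_boundary (slab e n)) \<le> 2"
proof -
  let ?B = "T.arc_boundary (slab e n)"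
  \<comment> \<open>An arc leaving the slab upwards starts at height \<open>n\<close>, one leaving it downwards at \<open>- n\<close>.\<close>
  have exit: "height e (tail T a) = int n * G.net_crossings e [\<pi>e a] \<and> \<pi>e a \<in> G.edge e"
    if "a \<in> ?B" for a
    using that height_step[of a e]
    by (auto simp: T.arc_boundary_def slab_def G.net_crossings_def G.edge_def split: if_splits)
  have "inj_on \<pi>e ?B"
  proof (rule inj_onI)
    fix a b assume same_projection: "a \<in> ?B" "b \<in> ?B" "\<pi>e a = \<pi>e b"
    then have arcs: "a \<in> arcs T" "b \<in> arcs T" by (auto simp: T.arc_boundary_def)
    moreover have "height e (tail T a) = height e (tail T b)" using exit same_projection by simp
    moreover have "\<pi>v (tail T a) = \<pi>v (tail T b)" using tail_\<pi>e arcs same_projection(3) by metis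
    ultimately have "tail T a = tail T b"
      by (intro vertex_determined_by_height) auto
    then show "a = b" using \<pi>e_eq_iff arcs same_projection(3) by blast
  qed
  moreover have "\<pi>e ` ?B \<subseteq> G.edge e" using exit by blast
  ultimately have "card ?B \<le> card (G.edge e)"
    by (rule card_inj_on_le) (simp add: G.edge_def)
  also have "\<dots> \<le> 2" by (simp add: G.edge_def card_insert_if)
  finally show ?thesis .
qed

lemma exists_Foelner_set:
  assumes "0 < \<epsilon>"
  shows "\<exists>S\<subseteq>verts T. finite S \<and> real (card (T.arc_boundary S)) < \<epsilon> * real (card S)"
proof (cases "finite (verts T)")
  case True
  have "T.arc_boundary (verts T) = {}" by (auto simp: T.arc_boundary_def)
  moreover have "0 < card (verts T)" using True T.root by (auto simp: card_gt_0_iff)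
  ultimately show ?thesis using True assms by (intro exI[of _ "verts T"]) simp
next
  case False
  obtain N :: nat where N_large: "2 / \<epsilon> < N" using reals_Archimedean2 by blast
  obtain F where F_props: "finite F" "F \<subseteq> verts T" "card F = N"
    using infinite_arbitrarily_large[OF False] by blast
  obtain n where "F \<subseteq> slab e n" by (rule finite_subset_slab[OF F_props(1,2)])
  then have "N \<le> card (slab e n)" using F_props(3) card_mono[OF finite_slab] by blast
  then have "2 / \<epsilon> < card (slab e n)" using N_large by linarith
  then have "2 < \<epsilon> * card (slab e n)" using assms by (simp add: pos_divide_less_eq mult.commute)
  moreover have "real (card (T.arc_boundary (slab e n))) \<le> 2"
    using card_arc_boundary_slab[of n] by simp
  ultimately have "real (card (T.arc_boundary (slab e n))) < \<epsilon> * card (slab e n)" by linarith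
  then show ?thesis
    using finite_slab by (intro exI[of _ "slab e n"]) (auto simp: slab_def)
qed

end

lemma eigenvalue_eq_rho_if_at_most_one_cycle:
  assumes "positive_eigenfunction G r x \<theta>" "at_most_one_cycle G r"
  shows "\<theta> = rho T"
proof -
  interpret x: positive_eigenfunction G r x \<theta> by fact
  interpret y: positive_eigenfunction T s "\<lambda>v. x (\<pi>v v)" \<theta>
    by (rule positive_eigenfunction_lift) fact
  obtain e where "G.feedback_edge e" using G.exists_feedback_edge[OF assms(2)] by blast
  then show ?thesis
  proof (intro y.eigenvalue_eq_rho_if_Foelner[where M = "Max (x ` verts G)"] exists_Foelner_set)
    show "0 < Min (x ` verts G)" using x.nonempty x.pos by simp
  qed (simp_all add: \<pi>v_in_verts)
qed

end

section \<open>Perturbed weights\<close>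

lemma eventually_at_right_less_if_DERIV_neg:
  fixes f :: "real \<Rightarrow> real"
  assumes "(f has_real_derivative l) (at x)" "l < 0"
  shows "\<forall>\<^sub>F t in at_right x. f t < f x"
proof -
  obtain d where decreasing: "0 < d" "\<And>h. 0 < h \<Longrightarrow> h < d \<Longrightarrow> f (x + h) < f x"
    using DERIV_neg_dec_right[OF assms] by blast
  have "f t < f x" if "x < t" "t < x + d" for t
    using decreasing(2)[of "t - x"] that by simp
  then show ?thesis
    unfolding eventually_at_right_field using decreasing(1) by (intro exI[of _ "x + d"]) auto
qed

lemma finite_strict_upper_bound:
  fixes W :: "real set"
  assumes "finite W" "\<And>w. w \<in> W \<Longrightarrow> w < \<theta>"
  obtains K where "K < \<theta>" "\<And>w. w \<in> W \<Longrightarrow> w \<le> K"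
  using assms by (intro that[of "Max (insert (\<theta> - 1) W)"]) auto

context positive_eigenfunction begin

definition perturbed_weight :: "('b \<Rightarrow> real) \<Rightarrow> real \<Rightarrow> 'b \<Rightarrow> real" where
  "perturbed_weight \<sigma> t a = y (head G a) / y (tail G a) - t * (\<sigma> a / (y (tail G a))\<^sup>2)"

lemma sum_perturbed_weight:
  assumes v_in_verts: "v \<in> verts G"
  shows "(\<Sum>a\<in>out_arcs G v. perturbed_weight \<sigma> t a) =
    \<theta> - t * ((\<Sum>a\<in>out_arcs G v. \<sigma> a) / (y v)\<^sup>2)"
proof -
  have "(\<Sum>a\<in>out_arcs G v. perturbed_weight \<sigma> t a) =
      (\<Sum>a\<in>out_arcs G v. y (head G a) / y v - t * (\<sigma> a / (y v)\<^sup>2))"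
    by (intro sum.cong) (auto simp: perturbed_weight_def)
  also have "\<dots> = (\<Sum>a\<in>out_arcs G v. y (head G a)) / y v -
      t * ((\<Sum>a\<in>out_arcs G v. \<sigma> a) / (y v)\<^sup>2)"
    by (simp add: sum_subtractf sum_divide_distrib sum_distrib_left)
  finally show ?thesis using eigen[OF v_in_verts] pos[OF v_in_verts] by simp
qed

definition perturbed_star_sum :: "('b \<Rightarrow> real) \<Rightarrow> 'b \<Rightarrow> real \<Rightarrow> real" where
  "perturbed_star_sum \<sigma> b t = 1 / perturbed_weight \<sigma> t b - perturbed_weight \<sigma> t (arev b) +
     (\<Sum>a\<in>out_arcs G (head G b). perturbed_weight \<sigma> t a)"

lemma perturbed_star_sum_0:
  assumes "b \<in> arcs G"
  shows "perturbed_star_sum \<sigma> b 0 = \<theta>"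
  using assms sum_perturbed_weight[of "head G b" \<sigma> 0]
  by (simp add: perturbed_star_sum_def perturbed_weight_def)

lemma DERIV_perturbed_star_sum:
  assumes b_in_arcs: "b \<in> arcs G"
  shows "(perturbed_star_sum \<sigma> b has_real_derivative
    (\<sigma> b + \<sigma> (arev b) - (\<Sum>a\<in>out_arcs G (head G b). \<sigma> a)) / (y (head G b))\<^sup>2) (at 0)"
proof -
  let ?u = "y (head G b)" and ?w = "y (tail G b)" and ?m = "\<Sum>a\<in>out_arcs G (head G b). \<sigma> a"
  have ends_pos: "0 < ?u" "0 < ?w" using pos b_in_arcs by simp_all
  have "perturbed_star_sum \<sigma> b =
      (\<lambda>t. 1 / (?u / ?w - t * (\<sigma> b / ?w\<^sup>2)) - (?w / ?u - t * (\<sigma> (arev b) / ?u\<^sup>2)) +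
        (\<theta> - t * (?m / ?u\<^sup>2)))"
    unfolding perturbed_star_sum_def sum_perturbed_weight[OF head_in_verts[OF b_in_arcs]]
    using b_in_arcs by (simp add: perturbed_weight_def)
  moreover have "(\<dots> has_real_derivative
      \<sigma> b / ?w\<^sup>2 / (?u / ?w)\<^sup>2 + \<sigma> (arev b) / ?u\<^sup>2 - ?m / ?u\<^sup>2) (at 0)"
    using ends_pos by (auto intro!: derivative_eq_intros simp: power2_eq_square)
  moreover have "\<sigma> b / ?w\<^sup>2 / (?u / ?w)\<^sup>2 = \<sigma> b / ?u\<^sup>2"
    using ends_pos by (simp add: power_divide)
  ultimately show ?thesis by (simp only: add_divide_distrib diff_divide_distrib)
qed

lemma eventually_perturbed_weight_pos:
  assumes "b \<in> arcs G"
  shows "\<forall>\<^sub>F t in at_right 0. 0 < perturbed_weight \<sigma> t b"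
proof -
  have "((\<lambda>t. perturbed_weight \<sigma> t b) \<longlongrightarrow>
      y (head G b) / y (tail G b) - 0 * (\<sigma> b / (y (tail G b))\<^sup>2)) (at_right 0)"
    unfolding perturbed_weight_def by (intro tendsto_intros)
  then show ?thesis using pos assms by (intro order_tendstoD(1)) auto
qed

lemma eventually_perturbed_star_sum_less:
  assumes b_in_arcs: "b \<in> arcs G" and "\<sigma> b + \<sigma> (arev b) < (\<Sum>a\<in>out_arcs G (head G b). \<sigma> a)"
  shows "\<forall>\<^sub>F t in at_right 0. perturbed_star_sum \<sigma> b t < \<theta>"
proof -
  have "(\<sigma> b + \<sigma> (arev b) - (\<Sum>a\<in>out_arcs G (head G b). \<sigma> a)) / (y (head G b))\<^sup>2 < 0"
    using assms(2) pos[of "head G b"] b_in_arcs by (simp add: divide_neg_pos)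
  from eventually_at_right_less_if_DERIV_neg[OF DERIV_perturbed_star_sum[OF b_in_arcs] this]
  show ?thesis by (simp add: perturbed_star_sum_0[OF b_in_arcs])
qed

lemma exists_outward_weights_below_eigenvalue:
  fixes \<sigma> :: "'b \<Rightarrow> real"
  assumes "fin_digraph G"
    and star_sum_pos: "\<And>v. v \<in> verts G \<Longrightarrow> 0 < (\<Sum>a\<in>out_arcs G v. \<sigma> a)"
    and edge_sum_less: "\<And>b. b \<in> arcs G \<Longrightarrow>
      \<sigma> b + \<sigma> (arev b) < (\<Sum>a\<in>out_arcs G (head G b). \<sigma> a)"
  shows "\<exists>\<phi> K. K < \<theta> \<and> outward_weights \<phi> K"
proof -
  interpret fin_digraph G by fact
  have "\<forall>\<^sub>F t in at_right 0. 0 < t \<and>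
      (\<forall>b\<in>arcs G. 0 < perturbed_weight \<sigma> t b \<and> perturbed_star_sum \<sigma> b t < \<theta>)"
    using eventually_perturbed_weight_pos eventually_perturbed_star_sum_less edge_sum_less
    by (intro eventually_conj eventually_ball_finite eventually_at_right_less)
      (auto simp: eventually_conj_iff)
  then obtain t :: real where t_pos: "0 < t"
    and weight: "\<And>b. b \<in> arcs G \<Longrightarrow> 0 < perturbed_weight \<sigma> t b"
    and star: "\<And>b. b \<in> arcs G \<Longrightarrow> perturbed_star_sum \<sigma> b t < \<theta>"
    using eventually_happens'[OF trivial_limit_at_right_real] by blast
  let ?W = "(\<lambda>v. \<Sum>a\<in>out_arcs G v. perturbed_weight \<sigma> t a) ` verts G \<union>
    (\<lambda>b. perturbed_star_sum \<sigma> b t) ` arcs G"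
  have "(\<Sum>a\<in>out_arcs G v. perturbed_weight \<sigma> t a) < \<theta>" if v_in_verts: "v \<in> verts G" for v
  proof -
    have "0 < t * ((\<Sum>a\<in>out_arcs G v. \<sigma> a) / (y v)\<^sup>2)"
      using t_pos star_sum_pos[OF v_in_verts] pos[OF v_in_verts]
      by (intro mult_pos_pos divide_pos_pos zero_less_power)
    then show ?thesis by (simp only: sum_perturbed_weight[OF v_in_verts])
  qed
  then have "w < \<theta>" if "w \<in> ?W" for w using that star by blast
  then obtain K where "K < \<theta>" "\<And>w. w \<in> ?W \<Longrightarrow> w \<le> K"
    using finite_strict_upper_bound[of ?W \<theta>] finite_verts finite_arcs by blast
  then have "K < \<theta> \<and> outward_weights (perturbed_weight \<sigma> t) K"
    using weight by (auto simp: outward_weights_def perturbed_star_sum_def)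
  then show ?thesis by blast
qed

end

lemma (in bidirected_digraph) exists_constant_edge_and_star_sums:
  assumes "fin_digraph G" "Digraph_Component.connected G"
  obtains \<sigma> :: "'b \<Rightarrow> real" where
    "\<And>a. a \<in> arcs G \<Longrightarrow> \<sigma> a + \<sigma> (arev a) = 2 * card (verts G)"
    "\<And>v. v \<in> verts G \<Longrightarrow> (\<Sum>a\<in>out_arcs G v. \<sigma> a) = card (arcs G)"
proof -
  interpret fin_digraph G by fact
  let ?n = "real (card (verts G))" and ?m = "real (card (arcs G))"
  have "(\<Sum>v\<in>verts G. ?m - ?n * card (out_arcs G v)) =
      ?n * ?m - ?n * (\<Sum>v\<in>verts G. card (out_arcs G v))"
    by (simp add: sum_subtractf sum_distrib_left)
  also have "(\<Sum>v\<in>verts G. card (out_arcs G v)) = card (arcs G)"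
    using sum_out_arcs[of "\<lambda>_. 1 :: nat"] by simp
  finally have "(\<Sum>v\<in>verts G. ?m - ?n * card (out_arcs G v)) = 0" by simp
  then obtain \<eta> where "flow_with_divergence \<eta> (\<lambda>v. ?m - ?n * card (out_arcs G v))"
    using exists_flow_with_divergence[OF assms] by blast
  then show thesis
    by (intro that[of "\<lambda>a. ?n + \<eta> a"]) (simp_all add: flow_with_divergence_def sum.distrib)
qed

lemma (in tree_cover) rho_less_eigenvalue_if_more_edges_than_vertices:
  assumes "Digraph_Component.connected G" "positive_eigenfunction G r x \<theta>"
    and "2 * card (verts G) < card (arcs G)"
  shows "rho T < \<theta>"
proof -
  interpret x: positive_eigenfunction G r x \<theta> by fact
  obtain \<sigma> :: "'e \<Rightarrow> real" where "\<And>a. a \<in> arcs G \<Longrightarrow> \<sigma> a + \<sigma> (r a) = 2 * card (verts G)"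
    "\<And>v. v \<in> verts G \<Longrightarrow> (\<Sum>a\<in>out_arcs G v. \<sigma> a) = card (arcs G)"
    using G.exists_constant_edge_and_star_sums[OF G.fin_digraph_axioms assms(1)] by blast
  then obtain \<phi> K where "K < \<theta>" "G.outward_weights \<phi> K"
    using x.exists_outward_weights_below_eigenvalue[OF G.fin_digraph_axioms, of \<sigma>] assms(3) by auto
  then show ?thesis using rho_le_if_outward_weights by force
qed

section \<open>Universal covers\<close>

theorem theorem2:
  fixes G :: "('v, 'e) pre_digraph" and r :: "'e \<Rightarrow> 'e"
    and T :: "('w, 'f) pre_digraph" and s :: "'f \<Rightarrow> 'f"
  assumes "bidirected_digraph G r"
    and "fin_digraph G"
    and "Digraph_Component.connected G"
    and "is_universal_cover T s G r"
  shows "(lambda1 G = rho T \<longleftrightarrow> at_most_one_cycle G r) \<and>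
         (at_most_one_cycle G r \<longleftrightarrow> average_degree G \<le> 2)"
proof -
  obtain root \<pi>v \<pi>e where "tree_cover G r T s root \<pi>v \<pi>e"
    using universal_cover_imp_tree_cover assms(1,2,4) by blast
  then interpret tree_cover G r T s root \<pi>v \<pi>e .
  obtain x where Perron: "positive_eigenfunction G r x (lambda1 G)"
    using G.exists_Perron_eigenfunction assms(2,3) by blast
  have "card (verts G) > 0"
    using assms(3) by (auto simp: connected_conv card_gt_0_iff)
  then have average_degree_le_iff: "average_degree G \<le> 2 \<longleftrightarrow> card (arcs G) \<le> 2 * card (verts G)"
    by (auto simp: G.average_degree_eq divide_le_eq)
  have "lambda1 G = rho T" if "at_most_one_cycle G r"
    using eigenvalue_eq_rho_if_at_most_one_cycle Perron that by blast
  moreover have "average_degree G \<le> 2" if "lambda1 G = rho T"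
    using rho_less_eigenvalue_if_more_edges_than_vertices[OF assms(3) Perron] that
      average_degree_le_iff by force
  moreover have "at_most_one_cycle G r" if "average_degree G \<le> 2"
    using G.card_arcs_ge_if_two_cycles[OF assms(2,3)] that average_degree_le_iff by linarith
  ultimately show ?thesis by blast
qed

end
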